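(* (Orlicz-Urysohn inequality) Let $K\subset\mathbb{R}^n$ be a convex body with the origin in its interior and let $\phi:(0,\infty)\to(0,\infty)$ be an increasing convex function. Then $$\omega_\phi(K)\geq\omega_\phi(B_K).$$ If $\phi$ is strictly convex, equality holds if and only if $K$ is an origin-symmetric Euclidean ball.
   Context: A convex body is a compact convex subset of $\mathbb{R}^n$ with nonempty interior. $B_2^n$ is the closed unit Euclidean ball, $|\cdot|$ volume, $\omega_n=|B_2^n|$, $\mathrm{vrad}(K)=(|K|/\omega_n)^{1/n}$ and $B_K=\mathrm{vrad}(K)B_2^n$. $h_K(u)=\max_{x\in K}\langle x,u\rangle$ is the support function and $\sigma$ the spherical measure on the unit sphere $S^{n-1}$. The Orlicz $\phi$ mean width of $K$ is $$\omega_\phi(K)=\frac{1}{n\omega_n}\int_{S^{n-1}}\phi\big(h_K(u)\big)\,d\sigma(u).$$ An origin-symmetric Euclidean ball is $rB_2^n$ with $r>0$. *)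

theory Defs
  imports "HOL-Analysis.Analysis"
begin

definition convex_body :: "'a::euclidean_space set \<Rightarrow> bool" where
  "convex_body K \<longleftrightarrow> compact K \<and> convex K \<and> interior K \<noteq> {}"

abbreviation vol :: "'a::euclidean_space set \<Rightarrow> real" where
  "vol \<equiv> measure lebesgue"

definition vrad :: "'a::euclidean_space set \<Rightarrow> real" where
  "vrad K = (vol K / vol (cball 0 1 :: 'a set)) powr (1 / real DIM('a))"

definition vrad_ball :: "'a::euclidean_space set \<Rightarrow> 'a set" where
  "vrad_ball K = (\<lambda>x. vrad K *\<^sub>R x) ` cball 0 1"

text \<open>On compact sets the supremum is a maximum.\<close>

definition support_fun :: "'a::euclidean_space set \<Rightarrow> 'a \<Rightarrow> real" where
  "support_fun K u = (SUP x\<in>K. x \<bullet> u)"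

text \<open>
  The (unnormalised) spherical measure on the unit sphere, given by the usual cone formula:
  the measure of \<open>A\<close> is \<open>n\<close> times the volume of \<open>{t u | 0 < t \<le> 1, u \<in> A}\<close>.
  It is obtained as the push-forward of Lebesgue measure on the punctured unit ball under
  \<open>x \<mapsto> x / |x|\<close>, which is \<^const>\<open>sgn\<close> in a normed space.
\<close>

definition sphere_measure :: "'a::euclidean_space measure" where
  "sphere_measure =
     scale_measure (of_nat DIM('a))
       (distr (restrict_space lborel (cball 0 1 - {0})) (restrict_space borel (sphere 0 1)) sgn)"

definition orlicz_mean_width :: "(real \<Rightarrow> real) \<Rightarrow> 'a::euclidean_space set \<Rightarrow> real" where
  "orlicz_mean_width \<phi> K =
     1 / (real DIM('a) * vol (cball 0 1 :: 'a set)) *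
     (\<integral>u. \<phi> (support_fun K u) \<partial>(sphere_measure :: 'a measure))"

definition strictly_convex_on :: "'a::real_vector set \<Rightarrow> ('a \<Rightarrow> real) \<Rightarrow> bool" where
  "strictly_convex_on S f \<longleftrightarrow> convex S \<and>
     (\<forall>x\<in>S. \<forall>y\<in>S. \<forall>u>0. \<forall>v>0. x \<noteq> y \<longrightarrow> u + v = 1 \<longrightarrow>
        f (u *\<^sub>R x + v *\<^sub>R y) < u * f x + v * f y)"

definition origin_symmetric_ball :: "'a::euclidean_space set \<Rightarrow> bool" where
  "origin_symmetric_ball K \<longleftrightarrow> (\<exists>r>0. K = (\<lambda>x. r *\<^sub>R x) ` cball 0 1)"

text \<open>The following facts confirm the cone formula and the total mass \<open>n \<omega>\<^sub>n\<close>.\<close>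

lemma measurable_sgn_sphere:
  "sgn \<in> measurable (restrict_space lborel (cball 0 1 - {0 :: 'a::euclidean_space}))
           (restrict_space borel (sphere 0 1))"
proof -
  have "(sgn :: 'a \<Rightarrow> 'a) \<in> borel_measurable borel"
    unfolding sgn_div_norm[abs_def] by measurable
  then have "sgn \<in> borel_measurable (restrict_space lborel (cball 0 1 - {0 :: 'a}))"
    by (intro measurable_restrict_space1) simp
  then show ?thesis
    by (intro measurable_restrict_space2) (auto simp: space_restrict_space norm_sgn)
qed

lemma space_sphere_measure: "space sphere_measure = sphere 0 1"
  by (simp add: sphere_measure_def space_scale_measure space_restrict_space)

lemma emeasure_sphere_measure:
  fixes A :: "'a::euclidean_space set"
  assumes "A \<in> sets borel" "A \<subseteq> sphere 0 1"
  shows "emeasure sphere_measure A =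
           of_nat DIM('a) * emeasure lborel {t *\<^sub>R u | t u. 0 < t \<and> t \<le> 1 \<and> u \<in> A}"
proof -
  let ?B = "cball 0 1 - {0 :: 'a}"
  have A: "A \<in> sets (restrict_space borel (sphere 0 1))"
    using assms by (auto simp: sets_restrict_space_iff)
  have "sgn -` A \<inter> ?B = {t *\<^sub>R u | t u. 0 < t \<and> t \<le> 1 \<and> u \<in> A}" (is "_ = ?C")
  proof (intro set_eqI iffI)
    fix x assume x: "x \<in> sgn -` A \<inter> ?B"
    then have "x = norm x *\<^sub>R sgn x" "0 < norm x" "norm x \<le> 1" "sgn x \<in> A"
      by (auto simp: sgn_div_norm)
    then show "x \<in> ?C" by blast
  next
    fix x assume "x \<in> ?C"
    then obtain t u where *: "x = t *\<^sub>R u" "0 < t" "t \<le> 1" "u \<in> A" by blast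
    then have "norm u = 1" using assms by auto
    then show "x \<in> sgn -` A \<inter> ?B"
      using * by (auto simp: sgn_scaleR sgn_div_norm)
  qed
  moreover have "emeasure (restrict_space lborel ?B) (sgn -` A \<inter> ?B)
      = emeasure lborel (sgn -` A \<inter> ?B)"
    by (intro emeasure_restrict_space) auto
  ultimately show ?thesis
    using A by (simp add: sphere_measure_def emeasure_distr[OF measurable_sgn_sphere]
        space_restrict_space)
qed

lemma measure_sphere_measure:
  "measure sphere_measure (sphere 0 1 :: 'a::euclidean_space set)
     = real DIM('a) * vol (cball 0 1 :: 'a set)"
proof -
  have "{t *\<^sub>R u | t u. 0 < t \<and> t \<le> 1 \<and> u \<in> sphere 0 1} = cball 0 1 - {0 :: 'a}"
  proof (intro set_eqI iffI)
    fix x :: 'a assume "x \<in> cball 0 1 - {0}"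
    then have "x = norm x *\<^sub>R sgn x" "0 < norm x" "norm x \<le> 1" "sgn x \<in> sphere 0 1"
      by (auto simp: sgn_div_norm)
    then show "x \<in> {t *\<^sub>R u | t u. 0 < t \<and> t \<le> 1 \<and> u \<in> sphere 0 1}" by blast
  qed auto
  moreover have "emeasure lborel (cball 0 1 - {0 :: 'a}) = emeasure lborel (cball 0 1 :: 'a set)"
    by (subst emeasure_Diff) auto
  ultimately have "emeasure sphere_measure (sphere 0 1 :: 'a set)
      = of_nat DIM('a) * emeasure lborel (cball 0 1 :: 'a set)"
    by (subst emeasure_sphere_measure) auto
  then show ?thesis
    by (simp add: measure_def enn2real_mult)
qed

end

theory Submission
  imports Defs
begin

text \<open>
  Jensen's inequality bounds \<open>\<omega>\<^sub>\<phi>(K)\<close> below by \<open>\<phi>(m)\<close>, where \<open>m\<close> is the mean of \<open>h\<^sub>K\<close> over the sphere, and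
  Urysohn's inequality \<open>m \<ge> vrad K\<close> finishes the estimate because \<open>\<phi>\<close> is increasing. For strictly
  convex \<open>\<phi>\<close>, equality in Jensen alone already makes \<open>h\<^sub>K\<close> constant, so the equality case of
  Urysohn is never needed.

  Urysohn's inequality comes from two bounds on \<open>|B + tK|\<close>, where \<open>B\<close> is the unit ball. By
  Brunn--Minkowski it is at least \<open>|B| (1 + t vrad K)\<^sup>n\<close>. On the other hand, testing a point
  \<open>x = y + tk\<close> against its own direction \<open>u\<close> gives \<open>|x| \<le> 1 + t h\<^sub>K(u)\<close>, so in polar coordinates
  \<open>|B + tK|\<close> is at most \<open>(1/n) \<integral> (1 + t h\<^sub>K)\<^sup>n d\<sigma>\<close>. Comparing the terms of first order in \<open>t\<close>
  yields the claim.

  Brunn--Minkowski is proved by the Hadwiger--Ohmann argument: for finite unions of disjoint boxes,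
  cut one set by a coordinate hyperplane separating two of its boxes and the other by a parallel
  hyperplane in the same volume ratio, and induct on the number of boxes; single boxes reduce to
  the AM-GM inequality.
\<close>

section \<open>The Brunn--Minkowski inequality\<close>

text \<open>This is Brunn--Minkowski for boxes with side lengths \<open>p i\<close> and
  \<open>q i\<close>. Divide by the right-hand side and apply AM-GM to the ratios
  \<open>p i / (p i + q i)\<close> and \<open>q i / (p i + q i)\<close>; the two arithmetic means
  add up to 1.\<close>

lemma root_prod_add_le:
  fixes p q :: "'b \<Rightarrow> real"
  assumes S: "finite S" "S \<noteq> {}" and p: "\<And>i. i \<in> S \<Longrightarrow> 0 < p i" and q: "\<And>i. i \<in> S \<Longrightarrow> 0 < q i"
  shows "root (card S) (\<Prod>i\<in>S. p i) + root (card S) (\<Prod>i\<in>S. q i) \<le> root (card S) (\<Prod>i\<in>S. p i + q i)"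
proof -
  let ?n = "card S" and ?R = "root (card S)"
  have n: "0 < ?n" using S by (simp add: card_gt_0_iff)
  have P: "0 < (\<Prod>i\<in>S. p i + q i)" using p q by (intro prod_pos) (simp add: add_pos_pos)
  have AG: "?R (\<Prod>i\<in>S. r i) / ?R (\<Prod>i\<in>S. p i + q i) \<le> (\<Sum>i\<in>S. r i / (p i + q i)) / ?n"
    if r: "\<And>i. i \<in> S \<Longrightarrow> 0 < r i" for r
  proof -
    have pos: "0 < r i / (p i + q i)" if "i \<in> S" for i
      using p[OF that] q[OF that] r[OF that] by simp
    have "?R (\<Prod>i\<in>S. r i) / ?R (\<Prod>i\<in>S. p i + q i) = ?R (\<Prod>i\<in>S. r i / (p i + q i))"
      by (simp add: prod_dividef real_root_divide)
    also have "\<dots> = (\<Prod>i\<in>S. r i / (p i + q i)) powr (1 / ?n)"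
      using n prod_pos[of S "\<lambda>i. r i / (p i + q i)", OF pos] by (intro root_powr_inverse) auto
    also have "\<dots> \<le> (\<Sum>i\<in>S. r i / (p i + q i) / ?n)"
      using S pos by (intro arith_geom_mean) (auto intro: less_imp_le)
    finally show ?thesis by (simp add: sum_divide_distrib)
  qed
  have "(?R (\<Prod>i\<in>S. p i) + ?R (\<Prod>i\<in>S. q i)) / ?R (\<Prod>i\<in>S. p i + q i)
      \<le> ((\<Sum>i\<in>S. p i / (p i + q i)) + (\<Sum>i\<in>S. q i / (p i + q i))) / ?n"
    using AG[of p] AG[of q] p q by (simp add: add_divide_distrib)
  also have "(\<Sum>i\<in>S. p i / (p i + q i)) + (\<Sum>i\<in>S. q i / (p i + q i)) = (\<Sum>i\<in>S. 1)"
    unfolding sum.distrib[symmetric]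
  proof (rule sum.cong)
    fix i assume "i \<in> S"
    then have "0 < p i + q i" using p q by (simp add: add_pos_pos)
    then show "p i / (p i + q i) + q i / (p i + q i) = 1" by (simp flip: add_divide_distrib)
  qed simp
  finally show ?thesis using P n by (simp add: divide_le_eq)
qed

text \<open>Split \<open>z\<close> as \<open>x + (z - x)\<close> so that, in every coordinate, both
  summands occupy the same relative position in their own boxes as \<open>z\<close> does in the
  large one.\<close>

lemma box_sum_subset:
  fixes a b c d :: "'a::euclidean_space"
  assumes "box a b \<noteq> {}" "box c d \<noteq> {}"
  shows "box (a + c) (b + d) \<subseteq> box a b + box c d"
proof
  fix z assume z: "z \<in> box (a + c) (b + d)"
  \<comment> \<open>\<open>w i\<close> is the relative position of \<open>z\<close> along side
    \<open>i\<close> of the large box, a number strictly between 0 and 1.\<close>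
  define w where "w i = ((z - a - c) \<bullet> i) / ((b - a + d - c) \<bullet> i)" for i
  define x where "x = a + (\<Sum>i\<in>Basis. (w i * ((b - a) \<bullet> i)) *\<^sub>R i)"
  have xi: "x \<bullet> i = a \<bullet> i + w i * ((b - a) \<bullet> i)" if "i \<in> Basis" for i
    using that by (simp add: x_def inner_add_left)
  have ab: "0 < (b - a) \<bullet> i" "0 < (d - c) \<bullet> i" if "i \<in> Basis" for i
    using assms that by (auto simp: box_ne_empty inner_diff_left)
  have w: "0 < w i" "w i < 1" if "i \<in> Basis" for i
    using z that ab[OF that] by (auto simp: w_def mem_box inner_diff_left inner_add_left)
  have zi: "(z - x) \<bullet> i = c \<bullet> i + w i * ((d - c) \<bullet> i)" if "i \<in> Basis" for i
  proof -
    have "(b - a + d - c) \<bullet> i \<noteq> 0" using ab[OF that] by (simp add: inner_diff_left inner_add_left)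
    then have "w i * ((b - a + d - c) \<bullet> i) = (z - a - c) \<bullet> i" by (simp add: w_def)
    then show ?thesis using xi[OF that] by (simp add: inner_diff_left inner_add_left algebra_simps)
  qed
  have conv: "l < l + v * (u - l) \<and> l + v * (u - l) < u" if "l < u" "0 < v" "v < 1" for l u v :: real
  proof -
    have "v * (u - l) < 1 * (u - l)" using that by (intro mult_strict_right_mono) auto
    moreover have "0 < v * (u - l)" using that by simp
    ultimately show ?thesis by auto
  qed
  have "x \<in> box a b"
    using conv w xi ab by (auto simp: mem_box inner_diff_left)
  moreover have "z - x \<in> box c d"
    unfolding mem_box using conv w zi ab by (simp add: inner_diff_left)
  ultimately have "x + (z - x) \<in> box a b + box c d" by (rule set_plus_intro)
  then show "z \<in> box a b + box c d" by simp
qed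

section \<open>Minkowski sums and cuts by coordinate hyperplanes\<close>

lemma set_plus_eq_UN: "A + B = (\<Union>x\<in>A. \<Union>y\<in>B. {x + y})"
  by (auto simp: set_plus_def)

lemma open_set_plus: "open A \<Longrightarrow> open (A + B)" for A B :: "'a::real_normed_vector set"
  unfolding set_plus_eq_UN by (rule open_sums) simp

lemma bounded_set_plus: "bounded A \<Longrightarrow> bounded B \<Longrightarrow> bounded (A + B)"
  for A B :: "'a::real_normed_vector set"
  unfolding set_plus_eq_UN by (rule bounded_sums)

lemma open_inner_halfspaces:
  fixes i :: "'a::real_inner"
  shows "open {x. x \<bullet> i < s}" "open {x. s < x \<bullet> i}"
  by (auto intro!: open_Collect_less continuous_intros)

lemma lmeasurable_Int_open:
  fixes A :: "'a::euclidean_space set"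
  shows "A \<in> lmeasurable \<Longrightarrow> open U \<Longrightarrow> A \<inter> U \<in> lmeasurable"
  by (intro fmeasurable_Int_fmeasurable) auto

text \<open>The hyperplane itself is a null set. Using strict inequalities on both sides keeps the
  pieces of an open set open.\<close>

lemma vol_split_hyperplane:
  fixes A :: "'a::euclidean_space set"
  assumes "A \<in> lmeasurable" "i \<in> Basis"
  shows "vol A = vol (A \<inter> {x. x \<bullet> i < s}) + vol (A \<inter> {x. s < x \<bullet> i})"
proof -
  have m: "A \<inter> {x. x \<bullet> i < s} \<in> lmeasurable" "A \<inter> {x. s < x \<bullet> i} \<in> lmeasurable"
    using assms by (auto intro!: lmeasurable_Int_open open_inner_halfspaces)
  have "vol A = vol ((A \<inter> {x. x \<bullet> i < s}) \<union> (A \<inter> {x. s < x \<bullet> i}))"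
  proof (rule measure_negligible_symdiff[OF \<open>A \<in> lmeasurable\<close>, symmetric])
    show "negligible ((A - (A \<inter> {x. x \<bullet> i < s} \<union> A \<inter> {x. s < x \<bullet> i})) \<union>
       ((A \<inter> {x. x \<bullet> i < s} \<union> A \<inter> {x. s < x \<bullet> i}) - A))"
      by (rule negligible_subset[OF negligible_standard_hyperplane[OF \<open>i \<in> Basis\<close>, of s]]) auto
  qed
  also have "\<dots> = vol (A \<inter> {x. x \<bullet> i < s}) + vol (A \<inter> {x. s < x \<bullet> i})"
    using m by (intro measure_Un2[THEN trans]) (auto simp: intro!: arg_cong[where f=vol])
  finally show ?thesis .
qed

text \<open>The volume gained between the two cuts fits into a slab of the surrounding box, of
  thickness \<open>t - s\<close>. This is the Lipschitz estimate that makes the volume below a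
  moving hyperplane continuous.\<close>

lemma vol_slab_le:
  fixes a :: "'a::euclidean_space"
  assumes A: "A \<in> lmeasurable" "A \<subseteq> cbox (- a) a" and i: "i \<in> Basis" and "s \<le> t"
    and a: "\<And>j. j \<in> Basis \<Longrightarrow> 0 \<le> a \<bullet> j"
  shows "vol (A \<inter> {x. x \<bullet> i < t}) - vol (A \<inter> {x. x \<bullet> i < s}) \<le> (t - s) * (\<Prod>j\<in>Basis - {i}. 2 * (a \<bullet> j))"
proof -
  \<comment> \<open>The corners \<open>- a\<close> and \<open>a\<close> with coordinate
    \<open>i\<close> reset to \<open>s\<close> and \<open>t\<close>; they span the slab.\<close>
  define l where "l = - a + (s + a \<bullet> i) *\<^sub>R i"
  define u where "u = a + (t - a \<bullet> i) *\<^sub>R i"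
  have l: "l \<bullet> j = (if j = i then s else - (a \<bullet> j))" and u: "u \<bullet> j = (if j = i then t else a \<bullet> j)"
    if "j \<in> Basis" for j
    using that i by (auto simp: l_def u_def inner_add_left inner_diff_left inner_Basis)
  have m: "A \<inter> {x. x \<bullet> i < r} \<in> lmeasurable" for r
    using A by (auto intro!: lmeasurable_Int_open open_inner_halfspaces)
  have "A \<inter> {x. x \<bullet> i < t} \<subseteq> (A \<inter> {x. x \<bullet> i < s}) \<union> cbox l u"
  proof
    fix x assume x: "x \<in> A \<inter> {x. x \<bullet> i < t}"
    then have "x \<in> cbox l u" if "s \<le> x \<bullet> i"
      using A(2) l u that by (auto simp: mem_box subset_iff)
    then show "x \<in> (A \<inter> {x. x \<bullet> i < s}) \<union> cbox l u" using x by fastforce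
  qed
  then have "vol (A \<inter> {x. x \<bullet> i < t}) \<le> vol ((A \<inter> {x. x \<bullet> i < s}) \<union> cbox l u)"
    using m by (intro measure_mono_fmeasurable) (auto intro: fmeasurable.Un)
  also have "\<dots> \<le> vol (A \<inter> {x. x \<bullet> i < s}) + vol (cbox l u)"
    using m by (intro measure_Un_le) auto
  also have "vol (cbox l u) = (\<Prod>j\<in>Basis. u \<bullet> j - l \<bullet> j)"
    using l u a \<open>s \<le> t\<close> by (subst measure_completion) (auto simp: measure_lborel_cbox_eq inner_diff_left)
  also have "\<dots> = (t - s) * (\<Prod>j\<in>Basis - {i}. 2 * (a \<bullet> j))"
    using i by (subst prod.remove[of _ i]) (auto simp: l u intro!: prod.cong)
  finally show ?thesis by simp
qed

text \<open>The volume below height \<open>t\<close> is Lipschitz in \<open>t\<close> and runs from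
  0 to \<open>vol A\<close>, so the intermediate value theorem applies.\<close>

lemma exists_proportional_slice:
  fixes A :: "'a::euclidean_space set"
  assumes A: "open A" "bounded A" and i: "i \<in> Basis" and r: "0 < r" "r < 1"
  shows "\<exists>t. vol (A \<inter> {x. x \<bullet> i < t}) = r * vol A"
proof -
  have mA: "A \<in> lmeasurable" using A by (simp add: lmeasurable_open)
  obtain a where a0: "A \<subseteq> cbox (- a) a" using A bounded_subset_cbox_symmetric by metis
  show ?thesis
  proof (cases "A = {}")
    case False
    then have a: "0 \<le> a \<bullet> j" if "j \<in> Basis" for j
      using a0 that by (fastforce simp: mem_box)
    define f where "f t = vol (A \<inter> {x. x \<bullet> i < t})" for t
    define C where "C = (\<Prod>j\<in>Basis - {i}. 2 * (a \<bullet> j))"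
    have C: "0 \<le> C" unfolding C_def using a by (intro prod_nonneg) auto
    have mono: "f s \<le> f t" if "s \<le> t" for s t
      unfolding f_def using mA that
      by (intro measure_mono_fmeasurable)
        (auto intro!: fmeasurableD lmeasurable_Int_open open_inner_halfspaces)
    have lip: "f t - f s \<le> C * (t - s)" if "s \<le> t" for s t
      using vol_slab_le[OF mA a0 i that a] by (simp add: f_def C_def mult.commute)
    have "C-lipschitz_on UNIV f"
    proof (rule lipschitz_onI[OF _ C])
      fix s t :: real
      show "dist (f s) (f t) \<le> C * dist s t"
        using mono[of s t] mono[of t s] lip[of s t] lip[of t s]
        by (cases "s \<le> t") (auto simp: dist_real_def)
    qed
    then have cont: "continuous_on UNIV f" by (rule lipschitz_on_continuous_on)
    have "A \<inter> {x. x \<bullet> i < - (a \<bullet> i)} = {}" using a0 i by (fastforce simp: mem_box)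
    then have lo: "f (- (a \<bullet> i)) = 0" by (simp add: f_def)
    \<comment> \<open>The closed bounding box includes height \<open>a \<bullet> i\<close>; going
      one unit higher puts all of it strictly below the cut.\<close>
    have "A \<inter> {x. x \<bullet> i < a \<bullet> i + 1} = A" using a0 i by (fastforce simp: mem_box)
    then have hi: "f (a \<bullet> i + 1) = vol A" by (simp add: f_def)
    have "\<exists>t\<ge>- (a \<bullet> i). t \<le> a \<bullet> i + 1 \<and> f t = r * vol A"
      using r a[OF i] lo hi cont
      by (intro IVT') (auto intro: continuous_on_subset mult_left_le_one_le)
    then show ?thesis by (auto simp: f_def)
  qed auto
qed

section \<open>Finite families of disjoint open boxes\<close>

definition box_family :: "'a::euclidean_space set set \<Rightarrow> bool" where
  "box_family D \<longleftrightarrow> finite D \<and> (\<forall>d\<in>D. d \<noteq> {} \<and> (\<exists>a b. d = box a b)) \<and> disjoint D"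

text \<open>Empty intersections are discarded, so the number of boxes drops as soon as one box
  misses \<open>H\<close>. This is what drives the induction.\<close>

definition trim :: "'a set \<Rightarrow> 'a set set \<Rightarrow> 'a set set" where
  "trim H D = (\<lambda>d. d \<inter> H) ` D - {{}}"

lemma Union_trim: "\<Union>(trim H D) = \<Union>D \<inter> H"
  by (auto simp: trim_def)

lemma card_trim_le: "finite D \<Longrightarrow> card (trim H D) \<le> card D"
  unfolding trim_def by (meson card_Diff1_le card_image_le dual_order.trans finite_imageI)

lemma card_trim_less:
  assumes "finite D" "d \<in> D" "d \<inter> H = {}"
  shows "card (trim H D) < card D"
proof -
  have "trim H D = trim H (D - {d})" using assms by (auto simp: trim_def)
  also have "card \<dots> \<le> card (D - {d})" using assms by (intro card_trim_le) auto
  also have "\<dots> < card D" using assms by (intro card_Diff1_less)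
  finally show ?thesis .
qed

text \<open>A cut orthogonal to a coordinate axis moves only one coordinate of one corner, so
  trimming a box family by a half-space again gives boxes.\<close>

lemma box_Int_halfspace:
  fixes a b :: "'a::euclidean_space"
  assumes "i \<in> Basis"
  shows "\<exists>c d. box a b \<inter> {x. x \<bullet> i < s} = box c d"
    and "\<exists>c d. box a b \<inter> {x. s < x \<bullet> i} = box c d"
proof -
  define d where "d = b + (min (b \<bullet> i) s - b \<bullet> i) *\<^sub>R i"
  have d: "d \<bullet> j = (if j = i then min (b \<bullet> i) s else b \<bullet> j)" if "j \<in> Basis" for j
    using that assms by (auto simp: d_def inner_add_left inner_Basis)
  have "box a b \<inter> {x. x \<bullet> i < s} = box a d"
    using assms by (auto simp: mem_box d split: if_splits)
  then show "\<exists>c d. box a b \<inter> {x. x \<bullet> i < s} = box c d" by blast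
  define c where "c = a + (max (a \<bullet> i) s - a \<bullet> i) *\<^sub>R i"
  have c: "c \<bullet> j = (if j = i then max (a \<bullet> i) s else a \<bullet> j)" if "j \<in> Basis" for j
    using that assms by (auto simp: c_def inner_add_left inner_Basis)
  have "box a b \<inter> {x. s < x \<bullet> i} = box c b"
    using assms by (auto simp: mem_box c split: if_splits)
  then show "\<exists>c d. box a b \<inter> {x. s < x \<bullet> i} = box c d" by blast
qed

lemma box_family_trim:
  assumes D: "box_family D" and H: "\<And>a b. \<exists>c d. box a b \<inter> H = box c d"
  shows "box_family (trim H D)"
  using assms unfolding box_family_def
proof (intro conjI ballI)
  show "disjoint (trim H D)"
    using D unfolding box_family_def disjoint_def trim_def by blast
qed (auto simp: trim_def)

lemma open_Union_box_family: "box_family D \<Longrightarrow> open (\<Union>D)"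
  unfolding box_family_def by (auto intro!: open_Union)

lemma bounded_Union_box_family: "box_family D \<Longrightarrow> bounded (\<Union>D)"
  unfolding box_family_def by (auto intro!: bounded_Union)

lemma vol_open_pos:
  fixes A :: "'a::euclidean_space set"
  assumes "open A" "bounded A" "A \<noteq> {}"
  shows "0 < vol A"
proof -
  have "A \<in> lmeasurable" using assms by (simp add: lmeasurable_open)
  then have "vol A \<noteq> 0" using open_not_negligible[OF assms(1,3)] negligible_iff_measure0 by blast
  then show ?thesis using measure_nonneg[of lebesgue A] by linarith
qed

text \<open>With the \<open>n\<close>-th power taken, the lower bound scales linearly when both
  volumes are multiplied by the same factor, so bounds for separate pieces can be added.\<close>

definition brunn_minkowski :: "'a::euclidean_space set \<Rightarrow> 'a set \<Rightarrow> bool" where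
  "brunn_minkowski A B \<longleftrightarrow>
     (root DIM('a) (vol A) + root DIM('a) (vol B)) ^ DIM('a) \<le> vol (A + B)"

lemma brunn_minkowski_commute: "brunn_minkowski A B \<longleftrightarrow> brunn_minkowski B A"
  by (simp add: brunn_minkowski_def add.commute)

lemma brunn_minkowski_box:
  fixes a b c d :: "'a::euclidean_space"
  assumes "box a b \<noteq> {}" "box c d \<noteq> {}"
  shows "brunn_minkowski (box a b) (box c d)"
proof -
  have ab: "0 < (b - a) \<bullet> i" "0 < (d - c) \<bullet> i" if "i \<in> Basis" for i
    using assms that by (auto simp: box_ne_empty inner_diff_left)
  have content: "vol (box l u) = (\<Prod>i\<in>Basis. (u - l) \<bullet> i)"
    if "\<And>i. i \<in> Basis \<Longrightarrow> 0 < (u - l) \<bullet> i" for l u :: 'a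
    using that by (subst measure_completion) (auto simp: measure_lborel_box_eq inner_diff_left less_imp_le)
  have sum: "(b + d - (a + c)) \<bullet> i = (b - a) \<bullet> i + (d - c) \<bullet> i" for i
    by (simp add: inner_diff_left inner_add_left)
  have "root DIM('a) (vol (box a b)) + root DIM('a) (vol (box c d)) \<le> root DIM('a) (vol (box (a + c) (b + d)))"
    using ab root_prod_add_le[of "Basis :: 'a set" "\<lambda>i. (b - a) \<bullet> i" "\<lambda>i. (d - c) \<bullet> i"]
    by (subst (1 2 3) content) (simp_all add: sum add_pos_pos)
  then have "(root DIM('a) (vol (box a b)) + root DIM('a) (vol (box c d))) ^ DIM('a)
      \<le> (root DIM('a) (vol (box (a + c) (b + d)))) ^ DIM('a)"
    by (intro power_mono) (auto intro!: add_nonneg_nonneg)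
  also have "\<dots> = vol (box (a + c) (b + d))" by simp
  also have "\<dots> \<le> vol (box a b + box c d)"
    using box_sum_subset[OF assms]
    by (intro measure_mono_fmeasurable) (auto intro!: lmeasurable_open open_set_plus bounded_set_plus)
  finally show ?thesis by (simp add: brunn_minkowski_def)
qed

text \<open>The sum of the two lower pieces lies below height \<open>s + t\<close> and that of the
  upper pieces above it, so both fit disjointly into \<open>A + B\<close>. As both sets are cut in
  the ratio \<open>r\<close>, the bounds for the pieces are \<open>r * ?b\<close> and
  \<open>(1 - r) * ?b\<close>, which add up to \<open>?b\<close>.\<close>

lemma brunn_minkowski_bisect:
  fixes A B :: "'a::euclidean_space set"
  assumes A: "open A" "bounded A" and B: "open B" "bounded B" and i: "i \<in> Basis" and r: "0 < r" "r < 1"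
    and volA: "vol (A \<inter> {x. x \<bullet> i < s}) = r * vol A" and volB: "vol (B \<inter> {x. x \<bullet> i < t}) = r * vol B"
    and lower: "brunn_minkowski (A \<inter> {x. x \<bullet> i < s}) (B \<inter> {x. x \<bullet> i < t})"
    and upper: "brunn_minkowski (A \<inter> {x. s < x \<bullet> i}) (B \<inter> {x. t < x \<bullet> i})"
  shows "brunn_minkowski A B"
proof -
  let ?n = "DIM('a)"
  let ?S = "A + B" and ?b = "(root ?n (vol A) + root ?n (vol B)) ^ ?n"
  have volA': "vol (A \<inter> {x. s < x \<bullet> i}) = (1 - r) * vol A"
    using vol_split_hyperplane[of A i s] A i volA by (simp add: lmeasurable_open algebra_simps)
  have volB': "vol (B \<inter> {x. t < x \<bullet> i}) = (1 - r) * vol B"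
    using vol_split_hyperplane[of B i t] B i volB by (simp add: lmeasurable_open algebra_simps)
  have scale: "(root ?n (q * vol A) + root ?n (q * vol B)) ^ ?n = q * ?b" if "0 < q" for q
  proof -
    have "root ?n (q * vol A) + root ?n (q * vol B) = root ?n q * (root ?n (vol A) + root ?n (vol B))"
      by (simp add: real_root_mult algebra_simps)
    then show ?thesis using that by (simp add: power_mult_distrib)
  qed
  have S: "open ?S" "bounded ?S" using A B by (auto intro: open_set_plus bounded_set_plus)
  have m: "?S \<inter> {x. x \<bullet> i < s + t} \<in> lmeasurable" "?S \<inter> {x. s + t < x \<bullet> i} \<in> lmeasurable"
    using S by (auto intro!: lmeasurable_open bounded_Int open_Int
      intro: open_inner_halfspaces)
  have "r * ?b \<le> vol ((A \<inter> {x. x \<bullet> i < s}) + (B \<inter> {x. x \<bullet> i < t}))"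
    using lower scale[of r] r by (simp add: brunn_minkowski_def volA volB)
  also have "\<dots> \<le> vol (?S \<inter> {x. x \<bullet> i < s + t})"
    using m(1) A B by (intro measure_mono_fmeasurable)
      (auto intro!: fmeasurableD lmeasurable_open open_set_plus bounded_set_plus bounded_Int open_Int
        open_inner_halfspaces simp: inner_add_left elim!: set_plus_elim)
  finally have 1: "r * ?b \<le> vol (?S \<inter> {x. x \<bullet> i < s + t})" .
  have "(1 - r) * ?b \<le> vol ((A \<inter> {x. s < x \<bullet> i}) + (B \<inter> {x. t < x \<bullet> i}))"
    using upper scale[of "1 - r"] r by (simp add: brunn_minkowski_def volA' volB')
  also have "\<dots> \<le> vol (?S \<inter> {x. s + t < x \<bullet> i})"
    using m(2) A B by (intro measure_mono_fmeasurable)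
      (auto intro!: fmeasurableD lmeasurable_open open_set_plus bounded_set_plus bounded_Int open_Int
        open_inner_halfspaces simp: inner_add_left elim!: set_plus_elim)
  finally have 2: "(1 - r) * ?b \<le> vol (?S \<inter> {x. s + t < x \<bullet> i})" .
  have "?b = r * ?b + (1 - r) * ?b" by (simp add: algebra_simps)
  also have "\<dots> \<le> vol ?S"
    using 1 2 vol_split_hyperplane[of ?S i "s + t"] S i by (simp add: lmeasurable_open)
  finally show ?thesis by (simp add: brunn_minkowski_def)
qed

text \<open>A hyperplane separating two boxes of \<open>D\<close> leaves fewer boxes of
  \<open>D\<close> on each side. The matching cut of \<open>E\<close> does not increase its number
  of boxes, so the induction hypothesis covers both sides.\<close>

lemma brunn_minkowski_box_family_step:
  fixes D E :: "'a::euclidean_space set set"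
  assumes D: "box_family D" and E: "box_family E" "E \<noteq> {}" and two: "1 < card D"
    and IH: "\<And>D' E' :: 'a set set. \<lbrakk>box_family D'; box_family E'; D' \<noteq> {}; E' \<noteq> {};
      card D' + card E' < card D + card E\<rbrakk> \<Longrightarrow> brunn_minkowski (\<Union>D') (\<Union>E')"
  shows "brunn_minkowski (\<Union>D) (\<Union>E)"
proof -
  have fin: "finite D" "finite E" using D E by (auto simp: box_family_def)
  obtain p q where pq: "p \<in> D" "q \<in> D" "p \<noteq> q"
    using two by (metis One_nat_def card_le_Suc0_iff_eq fin(1) not_less)
  have "\<exists>p q i s. p \<in> D \<and> q \<in> D \<and> i \<in> Basis \<and> p \<subseteq> {x. x \<bullet> i < s} \<and> q \<subseteq> {x. s < x \<bullet> i}"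
  proof -
    obtain a b c d where ab: "p = box a b" "q = box c d" using D pq unfolding box_family_def by metis
    have ne: "box a b \<noteq> {}" "box c d \<noteq> {}" "box a b \<inter> box c d = {}"
      using D pq ab by (auto simp: box_family_def disjoint_def)
    \<comment> \<open>Two nonempty open boxes are disjoint only if their projections to some
      coordinate axis are disjoint.\<close>
    then obtain i where i: "i \<in> Basis" "b \<bullet> i \<le> c \<bullet> i \<or> d \<bullet> i \<le> a \<bullet> i"
      unfolding disjoint_interval box_ne_empty by (meson leD)
    then show ?thesis
    proof (elim disjE)
      assume "b \<bullet> i \<le> c \<bullet> i"
      then have "p \<subseteq> {x. x \<bullet> i < b \<bullet> i}" "q \<subseteq> {x. b \<bullet> i < x \<bullet> i}"
        using i ab by (auto simp: mem_box intro: le_less_trans)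
      then show ?thesis using i pq by blast
    next
      assume "d \<bullet> i \<le> a \<bullet> i"
      then have "q \<subseteq> {x. x \<bullet> i < d \<bullet> i}" "p \<subseteq> {x. d \<bullet> i < x \<bullet> i}"
        using i ab by (auto simp: mem_box intro: le_less_trans)
      then show ?thesis using i pq by blast
    qed
  qed
  then obtain p q i s where pq: "p \<in> D" "q \<in> D" "i \<in> Basis" "p \<subseteq> {x. x \<bullet> i < s}" "q \<subseteq> {x. s < x \<bullet> i}"
    by blast
  have ne: "p \<noteq> {}" "q \<noteq> {}" using D pq by (auto simp: box_family_def)
  note A = open_Union_box_family[OF D] bounded_Union_box_family[OF D]
  note B = open_Union_box_family[OF E(1)] bounded_Union_box_family[OF E(1)]
  have neE: "\<Union>E \<noteq> {}" using E by (auto simp: box_family_def)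
  let ?L = "\<lambda>s. {x. x \<bullet> i < s}" and ?U = "\<lambda>s. {x. s < x \<bullet> i}"
  have op: "open (?L t)" "open (?U t)" for t
    by (rule open_inner_halfspaces)+
  \<comment> \<open>This ratio is strictly between 0 and 1 because \<open>p\<close> lies below the
    cut and \<open>q\<close> above it. The cut of \<open>E\<close> has to reproduce it.\<close>
  define r where "r = vol (\<Union>D \<inter> ?L s) / vol (\<Union>D)"
  have pos: "0 < vol (\<Union>D \<inter> ?L s)" "0 < vol (\<Union>D \<inter> ?U s)"
    using A op pq ne
    by (auto intro!: vol_open_pos open_Int bounded_Int simp del: measure_completion)
  have split: "vol (\<Union>D) = vol (\<Union>D \<inter> ?L s) + vol (\<Union>D \<inter> ?U s)"
    using A pq by (intro vol_split_hyperplane) (auto intro: lmeasurable_open)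
  have r: "0 < r" "r < 1" using pos split by (auto simp: r_def)
  have volA: "vol (\<Union>D \<inter> ?L s) = r * vol (\<Union>D)" using pos split by (simp add: r_def)
  obtain t where volB: "vol (\<Union>E \<inter> ?L t) = r * vol (\<Union>E)"
    using exists_proportional_slice[OF B pq(3) r] by blast
  have posE: "0 < vol (\<Union>E)" using B neE by (intro vol_open_pos)
  have split': "vol (\<Union>E) = vol (\<Union>E \<inter> ?L t) + vol (\<Union>E \<inter> ?U t)"
    using B pq by (intro vol_split_hyperplane) (auto intro: lmeasurable_open)
  have "0 < vol (\<Union>E \<inter> ?L t)" using volB r posE by simp
  moreover have "0 < vol (\<Union>E \<inter> ?U t)"
  proof -
    have "vol (\<Union>E \<inter> ?U t) = (1 - r) * vol (\<Union>E)" using split' volB by (simp add: algebra_simps)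
    then show ?thesis using r posE by simp
  qed
  ultimately have neq: "trim (?L t) E \<noteq> {}" "trim (?U t) E \<noteq> {}"
    by (metis Union_empty Union_trim less_irrefl measure_empty)+
  have neq': "trim (?L s) D \<noteq> {}" "trim (?U s) D \<noteq> {}"
    using pos by (metis Union_empty Union_trim less_irrefl measure_empty)+
  have dis: "q \<inter> ?L s = {}" "p \<inter> ?U s = {}" using pq by fastforce+
  have lower: "brunn_minkowski (\<Union>(trim (?L s) D)) (\<Union>(trim (?L t) E))"
    using D E pq neq neq' box_Int_halfspace(1)[OF pq(3)] card_trim_le[OF fin(2), of "?L t"] card_trim_less[OF fin(1) pq(2) dis(1)]
    by (intro IH box_family_trim) auto
  have upper: "brunn_minkowski (\<Union>(trim (?U s) D)) (\<Union>(trim (?U t) E))"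
    using D E pq neq neq' box_Int_halfspace(2)[OF pq(3)] card_trim_le[OF fin(2), of "?U t"] card_trim_less[OF fin(1) pq(1) dis(2)]
    by (intro IH box_family_trim) auto
  show ?thesis
    using brunn_minkowski_bisect[OF A B pq(3) r volA volB] lower upper by (simp add: Union_trim)
qed

text \<open>The induction runs on the total number of boxes, which is symmetric in the two families.
  If \<open>E\<close> has several boxes, commutativity lets it play the role of the family that is
  cut.\<close>

lemma brunn_minkowski_box_family:
  fixes D E :: "'a::euclidean_space set set"
  assumes "box_family D" "box_family E" "D \<noteq> {}" "E \<noteq> {}"
  shows "brunn_minkowski (\<Union>D) (\<Union>E)"
  using assms
proof (induction "card D + card E" arbitrary: D E rule: less_induct)
  case less
  have fin: "finite D" "finite E" using less.prems by (auto simp: box_family_def)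
  then have card: "1 \<le> card D" "1 \<le> card E" using less.prems by (auto simp: Suc_le_eq card_gt_0_iff)
  consider "1 < card D" | "1 < card E" | "card D = 1" "card E = 1" using card by linarith
  then show ?case
  proof cases
    case 1
    then show ?thesis
      by (rule brunn_minkowski_box_family_step[OF less.prems(1,2,4) _ less.hyps])
  next
    case 2
    have "brunn_minkowski (\<Union>E) (\<Union>D)"
    proof (rule brunn_minkowski_box_family_step)
      fix D' E' :: "'a set set"
      assume "box_family D'" "box_family E'" "D' \<noteq> {}" "E' \<noteq> {}" "card D' + card E' < card E + card D"
      then show "brunn_minkowski (\<Union>D') (\<Union>E')" by (intro less.hyps) simp_all
    qed (use less.prems 2 in auto)
    then show ?thesis by (rule brunn_minkowski_commute[THEN iffD1])
  next
    case 3
    then obtain p q where "D = {p}" "E = {q}" by (meson card_1_singletonE)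
    then show ?thesis using less.prems by (auto simp: box_family_def intro: brunn_minkowski_box)
  qed
qed

text \<open>Tile \<open>A\<close> by countably many closed boxes with disjoint interiors, keep
  finitely many that carry enough volume, and pass to their interiors.\<close>

lemma box_family_inner_approx:
  fixes A :: "'a::euclidean_space set"
  assumes A: "open A" "bounded A" and c: "0 \<le> c" "c < vol A"
  obtains D where "box_family D" "D \<noteq> {}" "\<Union>D \<subseteq> A" "c < vol (\<Union>D)"
proof -
  obtain a where a0: "A \<subseteq> cbox (- a) a" using A bounded_subset_cbox_symmetric by metis
  have "A \<noteq> {}" using c by auto
  then have a: "0 \<le> a \<bullet> j" if "j \<in> Basis" for j
    using a0 that by (fastforce simp: mem_box)
  \<comment> \<open>Padding by \<open>One\<close> makes the bounding box nondegenerate, as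
    \<open>covering_lemma\<close> requires.\<close>
  have ne: "box (- a - One) (a + One) \<noteq> {}"
    using a by (auto simp: box_ne_empty inner_diff_left inner_add_left intro: add_pos_pos) (smt (verit))
  have sub: "A \<subseteq> cbox (- a - One) (a + One)"
    using a0 by (fastforce simp: mem_box inner_diff_left inner_add_left)
  \<comment> \<open>Each tile is contained in \<open>g x\<close> for some \<open>x\<close> in
    \<open>A\<close>, so this choice confines the tiles to \<open>A\<close>. The value
    \<open>UNIV\<close> elsewhere only completes \<open>g\<close> to a gauge.\<close>
  define g where "g x = (if x \<in> A then A else UNIV)" for x
  have "gauge g" using A by (auto simp: gauge_def g_def)
  then obtain \<D> where \<D>: "countable \<D>" "\<And>K. K \<in> \<D> \<Longrightarrow> interior K \<noteq> {} \<and> (\<exists>c d. K = cbox c d)"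
    "pairwise (\<lambda>A B. interior A \<inter> interior B = {}) \<D>"
    "\<And>K. K \<in> \<D> \<Longrightarrow> \<exists>x\<in>A \<inter> K. K \<subseteq> g x" "A \<subseteq> \<Union>\<D>"
    using covering_lemma[OF sub ne] by metis
  have inA: "K \<subseteq> A" if "K \<in> \<D>" for K using \<D>(4)[OF that] by (auto simp: g_def)
  then have eq: "\<Union>\<D> = A" using \<D>(5) by blast
  obtain D' where D': "D' \<subseteq> \<D>" "finite D'" "vol (\<Union>\<D>) - (vol A - c) < vol (\<Union>D')"
  proof (rule measure_countable_Union_approachable[OF \<D>(1)])
    show "0 < vol A - c" using c by simp
    show "d \<in> lmeasurable" if "d \<in> \<D>" for d using \<D>(2)[OF that] by auto
    show "vol (\<Union>D') \<le> vol A" if "D' \<subseteq> \<D>" "finite D'" for D'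
    proof (rule measure_mono_fmeasurable)
      show "\<Union>D' \<subseteq> A" using inA that by blast
      show "\<Union>D' \<in> sets lebesgue"
        using \<D>(2) that by (intro sets.finite_Union) (auto dest!: subsetD[of D'], metis lborelD cbox_borel sets_completionI_sets sets_lborel)
      show "A \<in> lmeasurable" using A by (rule lmeasurable_open[rotated])
    qed
  qed
  have bx: "K = closure (interior K) \<and> interior K \<noteq> {} \<and> (\<exists>a b. interior K = box a b)" if K: "K \<in> D'" for K
  proof -
    obtain u v where "K = cbox u v" "interior K \<noteq> {}" using \<D>(2)[of K] D'(1) K by (meson subsetD)
    then show ?thesis using closure_box[of u v] by (auto simp: interior_cbox)
  qed
  let ?D = "interior ` D'"
  have fam: "box_family ?D"
    unfolding box_family_def
  proof (intro conjI)
    show "disjoint ?D"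
    proof (rule disjointI)
      fix I J assume "I \<in> ?D" "J \<in> ?D" "I \<noteq> J"
      then obtain K L where "K \<in> D'" "L \<in> D'" "K \<noteq> L" "I = interior K" "J = interior L" by blast
      then show "I \<inter> J = {}" using pairwiseD[OF \<D>(3), of K L] D'(1) by (simp add: subset_iff)
    qed
  qed (use D' bx in auto)
  have "vol (\<Union>D') \<le> vol (\<Union>?D)"
  proof -
    \<comment> \<open>Passing to interiors loses only points on the frontiers of finitely many
      boxes, which are null sets.\<close>
    have "negligible (\<Union>D' - \<Union>?D)"
    proof (rule negligible_subset)
      show "negligible (\<Union>K\<in>D'. frontier K)"
      proof (rule negligible_Union)
        show "finite (frontier ` D')" using D' by simp
        fix F assume "F \<in> frontier ` D'"
        then show "negligible F" using \<D>(2) D'(1) by (auto intro!: negligible_convex_frontier) (metis convex_box(1) negligible_convex_frontier subsetD)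
      qed
      show "\<Union>D' - \<Union>?D \<subseteq> (\<Union>K\<in>D'. frontier K)"
        using closure_subset by (fastforce simp: frontier_def)
    qed
    moreover have "\<Union>?D \<subseteq> \<Union>D'" using interior_subset by blast
    ultimately have "vol (\<Union>D') = vol (\<Union>?D)"
      using open_Union_box_family[OF fam] bounded_Union_box_family[OF fam]
      by (intro measure_negligible_symdiff) (auto intro: lmeasurable_open simp: Diff_eq_empty_iff[THEN iffD2])
    then show ?thesis by simp
  qed
  then have lt: "c < vol (\<Union>?D)" using D'(3) eq by simp
  have "?D \<noteq> {}" using lt c by auto
  moreover have "\<Union>?D \<subseteq> A" using D'(1) inA interior_subset by fastforce
  ultimately show ?thesis using that fam lt by blast
qed

text \<open>Inner box families capture more than a fraction \<open>q\<close> of each volume. The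
  factor \<open>q\<close> comes out of the bound linearly, and \<open>q < 1\<close> is
  arbitrary.\<close>

theorem brunn_minkowski_open:
  fixes A B :: "'a::euclidean_space set"
  assumes A: "open A" "bounded A" "A \<noteq> {}" and B: "open B" "bounded B" "B \<noteq> {}"
  shows "brunn_minkowski A B"
proof -
  let ?n = "DIM('a)"
  let ?b = "(root ?n (vol A) + root ?n (vol B)) ^ ?n"
  have "?b \<le> vol (A + B)"
  proof (rule field_le_mult_one_interval)
    fix q :: real assume q: "0 < q" "q < 1"
    have pos: "0 < vol A" "0 < vol B" using A B by (simp_all add: vol_open_pos del: measure_completion)
    obtain D where D: "box_family D" "D \<noteq> {}" "\<Union>D \<subseteq> A" "q * vol A < vol (\<Union>D)"
      using box_family_inner_approx[OF A(1,2), of "q * vol A"] q pos by auto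
    obtain E where E: "box_family E" "E \<noteq> {}" "\<Union>E \<subseteq> B" "q * vol B < vol (\<Union>E)"
      using box_family_inner_approx[OF B(1,2), of "q * vol B"] q pos by auto
    have "root ?n (q * vol A) + root ?n (q * vol B) = root ?n q * (root ?n (vol A) + root ?n (vol B))"
      by (simp add: real_root_mult algebra_simps)
    then have "q * ?b = (root ?n (q * vol A) + root ?n (q * vol B)) ^ ?n"
      using q by (simp add: power_mult_distrib)
    also have "\<dots> \<le> (root ?n (vol (\<Union>D)) + root ?n (vol (\<Union>E))) ^ ?n"
      using D E q pos by (intro power_mono add_mono real_root_le_mono add_nonneg_nonneg) auto
    also have "\<dots> \<le> vol (\<Union>D + \<Union>E)"
      using brunn_minkowski_box_family[OF D(1) E(1) D(2) E(2)] by (simp add: brunn_minkowski_def)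
    also have "\<dots> \<le> vol (A + B)"
      using A B D E by (intro measure_mono_fmeasurable set_plus_mono2)
        (auto intro!: fmeasurableD lmeasurable_open open_set_plus bounded_set_plus
          intro: open_Union_box_family bounded_Union_box_family)
    finally show "q * ?b \<le> vol (A + B)" .
  qed
  then show ?thesis by (simp add: brunn_minkowski_def)
qed


section \<open>Support functions\<close>

lemma inner_sgn_self: "x \<bullet> sgn x = norm x" for x :: "'a::real_inner"
  by (cases "x = 0") (simp_all add: sgn_div_norm dot_square_norm power2_eq_square)

lemma bdd_above_inner_image:
  fixes K :: "'a::euclidean_space set"
  assumes "bounded K"
  shows "bdd_above ((\<lambda>x. x \<bullet> u) ` K)"
proof -
  have "bounded ((\<lambda>x. x \<bullet> u) ` K)" by (rule bounded_linear_image[OF assms bounded_linear_inner_left])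
  then show ?thesis by (rule bounded_imp_bdd_above)
qed

lemma inner_le_support_fun: "bounded K \<Longrightarrow> x \<in> K \<Longrightarrow> x \<bullet> u \<le> support_fun K u"
  unfolding support_fun_def by (rule cSUP_upper[OF _ bdd_above_inner_image])

lemma support_fun_le: "K \<noteq> {} \<Longrightarrow> (\<And>x. x \<in> K \<Longrightarrow> x \<bullet> u \<le> c) \<Longrightarrow> support_fun K u \<le> c"
  unfolding support_fun_def by (rule cSUP_least)

text \<open>By Cauchy--Schwarz, any bound \<open>R\<close> on the norms of points of
  \<open>K\<close> is a Lipschitz constant.\<close>

lemma continuous_on_support_fun:
  fixes K :: "'a::euclidean_space set"
  assumes "bounded K" "K \<noteq> {}"
  shows "continuous_on S (support_fun K)"
proof -
  obtain R where R: "0 < R" "\<And>x. x \<in> K \<Longrightarrow> norm x \<le> R" using assms(1) by (auto simp: bounded_pos)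
  have le: "support_fun K u \<le> support_fun K v + R * norm (u - v)" for u v
  proof (rule support_fun_le[OF assms(2)])
    fix x assume x: "x \<in> K"
    have "x \<bullet> (u - v) \<le> norm x * norm (u - v)" by (rule norm_cauchy_schwarz)
    also have "\<dots> \<le> R * norm (u - v)" using R(2)[OF x] by (rule mult_right_mono) simp
    finally show "x \<bullet> u \<le> support_fun K v + R * norm (u - v)"
      using inner_le_support_fun[OF assms(1) x, of v] by (simp add: inner_diff_right)
  qed
  have "R-lipschitz_on UNIV (support_fun K)"
  proof (rule lipschitz_onI)
    show "dist (support_fun K u) (support_fun K v) \<le> R * dist u v" for u v
      using le[of u v] le[of v u] by (auto simp: dist_norm norm_minus_commute abs_le_iff)
  qed (use R in simp)
  then show ?thesis using lipschitz_on_continuous_on continuous_on_subset by blast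
qed

lemma support_fun_pos:
  fixes K :: "'a::euclidean_space set"
  assumes "bounded K" "0 \<in> interior K" "norm u = 1"
  shows "0 < support_fun K u"
proof -
  obtain r where r: "0 < r" "ball 0 r \<subseteq> K" using assms(2) by (auto simp: mem_interior)
  have "(r / 2) *\<^sub>R u \<in> K" using r assms(3) by (intro subsetD[OF r(2)]) simp
  from inner_le_support_fun[OF assms(1) this, of u] show ?thesis
    using assms(3) r by (simp add: power2_norm_eq_inner[symmetric])
qed

text \<open>Cauchy--Schwarz gives the upper bound, and the point \<open>r *\<^sub>R sgn u\<close>
  attains it. For \<open>u = 0\<close> this still works, since \<open>sgn 0 = 0\<close>.\<close>

lemma support_fun_scaled_cball:
  fixes u :: "'a::euclidean_space"
  assumes "0 \<le> r"
  shows "support_fun ((\<lambda>x. r *\<^sub>R x) ` cball 0 1) u = r * norm u"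
proof (rule antisym)
  show "support_fun ((\<lambda>x. r *\<^sub>R x) ` cball 0 1) u \<le> r * norm u"
  proof (rule support_fun_le)
    fix y :: 'a assume "y \<in> (\<lambda>x. r *\<^sub>R x) ` cball 0 1"
    then obtain x :: 'a where x: "y = r *\<^sub>R x" "norm x \<le> 1" by (metis imageE mem_cball_0)
    have "x \<bullet> u \<le> norm x * norm u" by (rule norm_cauchy_schwarz)
    also have "\<dots> \<le> 1 * norm u" using x by (intro mult_right_mono) auto
    finally show "y \<bullet> u \<le> r * norm u" using x assms by (simp add: mult_left_mono)
  qed simp
  have "r *\<^sub>R sgn u \<bullet> u \<le> support_fun ((\<lambda>x. r *\<^sub>R x) ` cball 0 1) u"
    by (intro inner_le_support_fun bounded_scaling) (auto simp: norm_sgn)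
  then show "r * norm u \<le> support_fun ((\<lambda>x. r *\<^sub>R x) ` cball 0 1) u"
    using inner_sgn_self[of u] by (simp add: inner_commute)
qed

text \<open>Testing a point of \<open>K\<close> in its own direction puts it in the ball.
  Conversely, a hyperplane separating a missing point of the ball from \<open>K\<close> yields a
  direction in which the support function is below \<open>m\<close>.\<close>

lemma eq_cball_if_support_fun_const:
  fixes K :: "'a::euclidean_space set"
  assumes K: "compact K" "convex K" "K \<noteq> {}" and "0 < m"
    and h: "\<And>u. norm u = 1 \<Longrightarrow> support_fun K u = m"
  shows "K = cball 0 m"
proof (rule antisym)
  show "K \<subseteq> cball 0 m"
  proof
    fix x assume x: "x \<in> K"
    show "x \<in> cball 0 m"
    proof (cases "x = 0")
      case False
      have "norm x = x \<bullet> sgn x" by (simp only: inner_sgn_self)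
      also have "\<dots> \<le> m"
        using inner_le_support_fun[OF compact_imp_bounded[OF K(1)] x, of "sgn x"] h[of "sgn x"] False
        by (simp add: norm_sgn)
      finally show ?thesis by simp
    qed (use \<open>0 < m\<close> in simp)
  qed
  show "cball 0 m \<subseteq> K"
  proof (rule ccontr)
    assume "\<not> cball 0 m \<subseteq> K"
    then obtain z where z: "norm z \<le> m" "z \<notin> K" by (auto simp: subset_iff)
    then obtain a b where ab: "a \<bullet> z < b" "\<forall>x\<in>K. b < a \<bullet> x"
      using separating_hyperplane_closed_point[OF K(2) compact_imp_closed[OF K(1)]] by blast
    have a: "a \<noteq> 0" using ab K(3) by auto
    \<comment> \<open>The normal \<open>a\<close> points from \<open>z\<close> towards
      \<open>K\<close>, so the outer direction at the hyperplane is \<open>- sgn a\<close>.\<close>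
    have "support_fun K (- sgn a) \<le> - b / norm a"
    proof (rule support_fun_le[OF K(3)])
      fix x assume "x \<in> K"
      then have "b / norm a \<le> (a \<bullet> x) / norm a" using ab(2) by (intro divide_right_mono) auto
      then show "x \<bullet> (- sgn a) \<le> - b / norm a"
        by (simp add: sgn_div_norm inner_commute divide_inverse mult.commute)
    qed
    then have "m \<le> - b / norm a" using h[of "- sgn a"] a by (simp add: norm_sgn)
    then have "m * norm a \<le> - b" using a by (simp add: field_simps)
    moreover have "- (a \<bullet> z) \<le> norm a * norm z" using Cauchy_Schwarz_ineq2[of a z] by linarith
    moreover have "norm a * norm z \<le> norm a * m" using z by (intro mult_left_mono) auto
    ultimately show False using ab(1) by (simp add: mult.commute)
  qed
qed

section \<open>The spherical measure\<close>

lemma sets_sphere_measure: "sets sphere_measure = sets (restrict_space borel (sphere 0 1))"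
  by (simp add: sphere_measure_def)

lemma measure_space_sphere_measure:
  "measure sphere_measure (space (sphere_measure :: 'a::euclidean_space measure))
     = real DIM('a) * vol (cball 0 1 :: 'a set)"
  by (simp add: space_sphere_measure measure_sphere_measure del: measure_completion)

lemma vol_unit_cball_pos: "0 < vol (cball 0 1 :: 'a::euclidean_space set)"
  by simp

lemma finite_measure_sphere_measure: "finite_measure (sphere_measure :: 'a::euclidean_space measure)"
proof
  \<comment> \<open>\<open>measure\<close> returns 0 where \<open>emeasure\<close> is infinite, so a
    positive value already proves finiteness.\<close>
  have "0 < measure sphere_measure (space (sphere_measure :: 'a measure))"
    unfolding measure_space_sphere_measure using vol_unit_cball_pos[where 'a='a]
    by (simp del: measure_completion)
  then show "emeasure sphere_measure (space (sphere_measure :: 'a measure)) \<noteq> \<infinity>"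
    by (auto simp: measure_def)
qed

lemma bounded_on_unit_sphere:
  fixes f :: "'a::euclidean_space \<Rightarrow> real"
  assumes "continuous_on (sphere 0 1) f"
  obtains B where "0 < B" "\<And>u. norm u = 1 \<Longrightarrow> \<bar>f u\<bar> \<le> B"
proof -
  have "bounded (f ` sphere 0 1)"
    using compact_continuous_image[OF assms] compact_sphere compact_imp_bounded by blast
  then obtain B where "0 < B" "\<forall>x\<in>f ` sphere 0 1. norm x \<le> B" unfolding bounded_pos by blast
  then show ?thesis using that[of B] by simp
qed

lemma borel_measurable_sphere_measure:
  fixes f :: "'a::euclidean_space \<Rightarrow> real"
  assumes "continuous_on (sphere 0 1) f"
  shows "f \<in> borel_measurable sphere_measure"
proof -
  have "f \<in> borel_measurable (restrict_space borel (sphere 0 1))"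
    by (rule borel_measurable_continuous_on_restrict[OF assms])
  then show ?thesis unfolding measurable_cong_sets[OF sets_sphere_measure refl] .
qed

lemma integrable_sphere_measure:
  fixes f :: "'a::euclidean_space \<Rightarrow> real"
  assumes f: "continuous_on (sphere 0 1) f"
  shows "integrable sphere_measure f"
proof -
  interpret finite_measure "sphere_measure :: 'a measure" by (rule finite_measure_sphere_measure)
  obtain B where B: "\<And>u. norm u = 1 \<Longrightarrow> \<bar>f u\<bar> \<le> B" using bounded_on_unit_sphere[OF f] by blast
  show ?thesis
    by (rule integrable_const_bound[of _ B])
      (use B borel_measurable_sphere_measure[OF f] in \<open>auto intro!: AE_I2 simp: space_sphere_measure\<close>)
qed

text \<open>For \<open>c = 1\<close> and \<open>A\<close> in the unit sphere this is the set in the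
  cone formula for \<open>sphere_measure\<close>, written without a quantified radius.\<close>

definition radial_cone :: "real \<Rightarrow> 'a::euclidean_space set \<Rightarrow> 'a set" where
  "radial_cone c A = {x. x \<noteq> 0 \<and> norm x \<le> c \<and> sgn x \<in> A}"

lemma borel_measurable_sgn: "(sgn :: 'a::euclidean_space \<Rightarrow> 'a) \<in> borel_measurable borel"
  unfolding sgn_div_norm[abs_def] by measurable

lemma borel_radial_cone:
  fixes A :: "'a::euclidean_space set"
  assumes "A \<in> sets borel"
  shows "radial_cone c A \<in> sets borel"
proof -
  have "radial_cone c A = (sgn -` A \<inter> space borel) \<inter> (cball 0 c - {0})"
    by (auto simp: radial_cone_def)
  moreover have "sgn -` A \<inter> space borel \<in> sets borel"
    using borel_measurable_sgn assms by (rule measurable_sets)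
  ultimately show ?thesis by simp
qed

lemma lmeasurable_radial_cone:
  fixes A :: "'a::euclidean_space set"
  assumes "A \<in> sets borel"
  shows "radial_cone c A \<in> lmeasurable"
proof (rule fmeasurableI2[OF lmeasurable_cball])
  show "radial_cone c A \<subseteq> cball 0 c" by (auto simp: radial_cone_def)
  show "radial_cone c A \<in> sets lebesgue" using borel_radial_cone[OF assms, of c] by simp
qed

lemma radial_cone_eq_image:
  fixes A :: "'a::euclidean_space set"
  assumes "0 < c"
  shows "radial_cone c A = (\<lambda>x. c *\<^sub>R x) ` radial_cone 1 A"
proof (intro set_eqI iffI)
  fix x assume "x \<in> radial_cone c A"
  then have "(1 / c) *\<^sub>R x \<in> radial_cone 1 A" using assms by (auto simp: radial_cone_def sgn_scaleR)
  moreover have "x = c *\<^sub>R ((1 / c) *\<^sub>R x)" using assms by simp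
  ultimately show "x \<in> (\<lambda>x. c *\<^sub>R x) ` radial_cone 1 A" by blast
qed (use assms in \<open>auto simp: radial_cone_def sgn_scaleR mult_left_le\<close>)

lemma vol_scaleR_image:
  fixes A :: "'a::euclidean_space set"
  shows "vol ((\<lambda>x. c *\<^sub>R x) ` A) = \<bar>c\<bar> ^ DIM('a) * vol A"
  using measure_lebesgue_affine[of c 0 A] by simp

text \<open>The cone formula settles \<open>c = 1\<close>, and dilation contributes the factor
  \<open>c ^ DIM('a)\<close>.\<close>

lemma vol_radial_cone:
  fixes A :: "'a::euclidean_space set"
  assumes A: "A \<in> sets borel" "A \<subseteq> sphere 0 1" and c: "0 < c"
  shows "real DIM('a) * vol (radial_cone c A) = c ^ DIM('a) * measure sphere_measure A"
proof -
  have "radial_cone 1 A = {t *\<^sub>R u | t u. 0 < t \<and> t \<le> 1 \<and> u \<in> A}"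
  proof (intro set_eqI iffI)
    fix x assume "x \<in> radial_cone 1 A"
    then have "x = norm x *\<^sub>R sgn x" "0 < norm x" "norm x \<le> 1" "sgn x \<in> A"
      by (auto simp: radial_cone_def sgn_div_norm)
    then show "x \<in> {t *\<^sub>R u | t u. 0 < t \<and> t \<le> 1 \<and> u \<in> A}" by blast
  next
    fix x assume "x \<in> {t *\<^sub>R u | t u. 0 < t \<and> t \<le> 1 \<and> u \<in> A}"
    then obtain t u where *: "x = t *\<^sub>R u" "0 < t" "t \<le> 1" "u \<in> A" by blast
    then have "norm u = 1" using A by auto
    then show "x \<in> radial_cone 1 A" using * by (auto simp: radial_cone_def sgn_scaleR sgn_div_norm)
  qed
  then have "emeasure sphere_measure A = of_nat DIM('a) * emeasure lborel (radial_cone 1 A)"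
    using emeasure_sphere_measure[OF A] by simp
  moreover have "radial_cone 1 A \<in> sets lborel" using borel_radial_cone[OF A(1)] by simp
  ultimately have "measure sphere_measure A = real DIM('a) * vol (radial_cone 1 A)"
    by (simp add: measure_def enn2real_mult)
  moreover have "vol (radial_cone c A) = c ^ DIM('a) * vol (radial_cone 1 A)"
    using c by (simp only: radial_cone_eq_image[OF c] vol_scaleR_image abs_of_pos)
  ultimately show ?thesis by simp
qed

lemma vol_star_le:
  fixes f :: "'a::euclidean_space \<Rightarrow> real"
  assumes f: "continuous_on (sphere 0 1) f" and pos: "\<And>u. norm u = 1 \<Longrightarrow> 0 < f u" and \<delta>: "0 < \<delta>"
    and S: "S \<in> sets lebesgue" and sub: "\<And>x. x \<in> S \<Longrightarrow> x \<noteq> 0 \<Longrightarrow> norm x \<le> f (sgn x)"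
  shows "real DIM('a) * vol S \<le> (\<integral>u. (f u + \<delta>) ^ DIM('a) \<partial>sphere_measure)"
proof -
  \<comment> \<open>Rounding \<open>f\<close> up to multiples of \<open>\<delta>\<close> covers \<open>S\<close> by finitely many cones of constant radius.\<close>
  let ?\<sigma> = "sphere_measure :: 'a measure" and ?n = "DIM('a)"
  interpret finite_measure ?\<sigma> by (rule finite_measure_sphere_measure)
  obtain B where B: "\<And>u. norm u = 1 \<Longrightarrow> \<bar>f u\<bar> \<le> B" using bounded_on_unit_sphere[OF f] by blast
  obtain J :: nat where J: "B / \<delta> < J" using reals_Archimedean2 by blast
  define c where "c j = (real j + 1) * \<delta>" for j :: nat
  define A where "A j = {u \<in> sphere 0 1. real j * \<delta> < f u \<and> f u \<le> c j}" for j :: nat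
  have c: "0 < c j" for j using \<delta> by (simp add: c_def add_pos_pos)
  have As: "A j \<in> sets ?\<sigma>" for j
  proof -
    have "A j = (f -` {real j * \<delta><..} \<inter> space ?\<sigma>) \<inter> (f -` {..c j} \<inter> space ?\<sigma>)"
      by (auto simp: A_def space_sphere_measure)
    then show ?thesis
      using borel_measurable_sphere_measure[OF f] by (auto intro!: measurable_sets sets.Int)
  qed
  have A: "A j \<in> sets borel" "A j \<subseteq> sphere 0 1" for j
    using As[of j] by (auto simp: sets_sphere_measure sets_restrict_space_iff A_def)
  have ind: "integrable ?\<sigma> (indicator (A j) :: 'a \<Rightarrow> real)" for j
    using As[of j] by (intro integrable_real_indicator) (auto simp: less_top[symmetric])
  have cover: "\<exists>j<J. u \<in> A j" if u: "norm u = 1" for u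
  proof -
    \<comment> \<open>The level sets \<open>A j\<close> exclude their lower end, hence ceiling minus
      one. As \<open>f u > 0\<close>, the ceiling is at least 1 and \<open>nat\<close> does not
      truncate.\<close>
    define j where "j = nat (\<lceil>f u / \<delta>\<rceil> - 1)"
    have "0 < f u / \<delta>" using pos[OF u] \<delta> by simp
    then have "0 < \<lceil>f u / \<delta>\<rceil>" by simp
    then have j: "real j = of_int \<lceil>f u / \<delta>\<rceil> - 1" by (simp add: j_def)
    have "real j < f u / \<delta>" "f u / \<delta> \<le> real j + 1" using j by linarith+
    then have "real j * \<delta> < f u" "f u \<le> c j" using \<delta> by (simp_all add: c_def field_simps)
    moreover have "f u / \<delta> \<le> B / \<delta>" using B[OF u] \<delta> by (intro divide_right_mono) auto
    then have "j < J" using \<open>real j < f u / \<delta>\<close> J by linarith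
    ultimately show ?thesis using u by (auto simp: A_def)
  qed
  have disj: "j = k" if "u \<in> A j" "u \<in> A k" for u j k
  proof -
    have "real j * \<delta> < (real k + 1) * \<delta>" "real k * \<delta> < (real j + 1) * \<delta>"
      using that by (auto simp: A_def c_def)
    then show ?thesis using \<delta> by (auto simp: mult_less_cancel_right)
  qed
  have sub': "S \<subseteq> (\<Union>j<J. radial_cone (c j) (A j)) \<union> {0}"
  proof
    fix x assume x: "x \<in> S"
    show "x \<in> (\<Union>j<J. radial_cone (c j) (A j)) \<union> {0}"
    proof (cases "x = 0")
      case False
      then obtain j where j: "j < J" "sgn x \<in> A j" using cover[of "sgn x"] by (auto simp: norm_sgn)
      then have "norm x \<le> c j" using sub[OF x False] by (auto simp: A_def)
      then show ?thesis using j False by (auto simp: radial_cone_def)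
    qed simp
  qed
  have m: "radial_cone (c j) (A j) \<in> lmeasurable" for j by (rule lmeasurable_radial_cone[OF A(1)])
  have "vol S \<le> vol ((\<Union>j<J. radial_cone (c j) (A j)) \<union> {0})"
    using m S sub' by (intro measure_mono_fmeasurable fmeasurable.Un fmeasurable.finite_UN)
      (auto intro: lmeasurable_compact)
  also have "\<dots> \<le> vol (\<Union>j<J. radial_cone (c j) (A j)) + vol {0 :: 'a}"
    using m by (intro measure_Un_le) (auto intro!: sets.finite_UN)
  also have "vol {0 :: 'a} = 0" by simp
  also have "vol (\<Union>j<J. radial_cone (c j) (A j)) \<le> (\<Sum>j<J. vol (radial_cone (c j) (A j)))"
    using m by (intro measure_UNION_le) auto
  finally have "real ?n * vol S \<le> (\<Sum>j<J. real ?n * vol (radial_cone (c j) (A j)))"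
    by (simp add: sum_distrib_left[symmetric] del: measure_completion)
  also have "\<dots> = (\<Sum>j<J. c j ^ ?n * measure ?\<sigma> (A j))"
    by (intro sum.cong refl vol_radial_cone A c)
  also have "\<dots> = (\<integral>u. (\<Sum>j<J. c j ^ ?n * indicator (A j) u) \<partial>?\<sigma>)"
    using ind sets.sets_into_space[OF As] by (subst Bochner_Integration.integral_sum)
      (auto intro!: sum.cong arg_cong[where f = "measure ?\<sigma>"] simp: Int_absorb2)
  also have "\<dots> \<le> (\<integral>u. (f u + \<delta>) ^ ?n \<partial>?\<sigma>)"
  proof (rule integral_mono)
    show "integrable ?\<sigma> (\<lambda>u. \<Sum>j<J. c j ^ ?n * indicator (A j) u)"
      using ind by (intro Bochner_Integration.integrable_sum integrable_mult_right)
    show "integrable ?\<sigma> (\<lambda>u. (f u + \<delta>) ^ ?n)"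
      by (intro integrable_sphere_measure continuous_intros f)
    fix u assume "u \<in> space ?\<sigma>"
    then have u: "norm u = 1" by (simp add: space_sphere_measure)
    obtain j where j: "j < J" "u \<in> A j" using cover[OF u] by blast
    \<comment> \<open>The level sets are disjoint, so only the term of the level containing
      \<open>u\<close> survives, and its radius exceeds \<open>f u\<close> by less than
      \<open>\<delta>\<close>.\<close>
    have "(\<Sum>k<J. c k ^ ?n * indicator (A k) u) = (\<Sum>k<J. if k = j then c j ^ ?n else 0)"
      using disj j by (intro sum.cong) (auto simp: indicator_def)
    also have "\<dots> = c j ^ ?n" using j by simp
    also have "\<dots> \<le> (f u + \<delta>) ^ ?n"
      using j c[of j] by (intro power_mono) (auto simp: A_def c_def algebra_simps)
    finally show "(\<Sum>k<J. c k ^ ?n * indicator (A k) u) \<le> (f u + \<delta>) ^ ?n" .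
  qed
  finally show ?thesis .
qed

section \<open>Urysohn's inequality\<close>

lemma vol_convex_interior:
  fixes K :: "'a::euclidean_space set"
  assumes "convex K" "bounded K"
  shows "vol (interior K) = vol K"
proof -
  have "negligible (frontier K)" by (rule negligible_convex_frontier[OF assms(1)])
  then show ?thesis by (rule measure_interior[OF assms(2)])
qed

text \<open>Comparison with \<open>exp\<close> and its quadratic bound on the unit interval controls
  everything beyond first order.\<close>

lemma power_one_plus_le:
  fixes y :: real
  assumes "0 \<le> y" "real n * y \<le> 1"
  shows "(1 + y) ^ n \<le> 1 + real n * y + (real n * y)\<^sup>2"
proof -
  have "(1 + y) ^ n \<le> exp y ^ n" using assms by (intro power_mono) auto
  also have "\<dots> = exp (real n * y)" by (simp add: exp_of_nat_mult)
  also have "\<dots> \<le> 1 + real n * y + (real n * y)\<^sup>2" using assms by (intro exp_bound) auto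
  finally show ?thesis .
qed

lemma vrad_eq_root:
  fixes K :: "'a::euclidean_space set"
  shows "vrad K = root DIM('a) (vol K / vol (cball 0 1 :: 'a set))"
proof (cases "vol K = 0")
  case False
  then have "0 < vol K / vol (cball 0 1 :: 'a set)"
    using vol_unit_cball_pos[where 'a='a] by (simp add: order_less_le del: measure_completion)
  then show ?thesis unfolding vrad_def by (subst root_powr_inverse) auto
qed (simp add: vrad_def del: measure_completion)

text \<open>The rounding error in \<open>vol_star_le\<close> is taken to be the square of
  \<open>t\<close>, so it does not affect the first-order comparison. The open ball and the interior
  of \<open>K\<close> are the sets to which \<open>brunn_minkowski_open\<close> will be
  applied.\<close>

lemma vol_ball_sum_le:
  fixes K :: "'a::euclidean_space set"
  assumes K: "bounded K" "0 \<in> interior K" and t: "0 < t"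
  shows "real DIM('a) * vol (ball 0 1 + (\<lambda>x. t *\<^sub>R x) ` interior K)
    \<le> (\<integral>u. (1 + t * support_fun K u + t\<^sup>2) ^ DIM('a) \<partial>sphere_measure)"
proof (rule vol_star_le)
  have ne: "K \<noteq> {}" using K interior_subset by blast
  show "continuous_on (sphere 0 1) (\<lambda>u. 1 + t * support_fun K u)"
    by (intro continuous_intros continuous_on_support_fun K ne)
  show "0 < 1 + t * support_fun K u" if "norm u = 1" for u
    using support_fun_pos[OF K that] t by (intro add_pos_pos mult_pos_pos) auto
  show "0 < t\<^sup>2" using t by simp
  have "open (ball 0 1 + (\<lambda>x. t *\<^sub>R x) ` interior K)" by (rule open_set_plus) simp
  then show "ball 0 1 + (\<lambda>x. t *\<^sub>R x) ` interior K \<in> sets lebesgue" by simp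
  fix x assume "x \<in> ball 0 1 + (\<lambda>x. t *\<^sub>R x) ` interior K" "x \<noteq> 0"
  then obtain y k where yk: "x = y + t *\<^sub>R k" "norm y < 1" "k \<in> K"
    using interior_subset by (fastforce elim!: set_plus_elim)
  have "norm x = x \<bullet> sgn x" by (simp only: inner_sgn_self)
  also have "\<dots> = y \<bullet> sgn x + t * (k \<bullet> sgn x)" by (simp add: yk(1) inner_add_left)
  also have "\<dots> \<le> 1 + t * support_fun K (sgn x)"
  proof (intro add_mono mult_left_mono)
    have "y \<bullet> sgn x \<le> norm y * norm (sgn x)" by (rule norm_cauchy_schwarz)
    then show "y \<bullet> sgn x \<le> 1" using yk \<open>x \<noteq> 0\<close> by (simp add: norm_sgn)
    show "k \<bullet> sgn x \<le> support_fun K (sgn x)" using K yk by (intro inner_le_support_fun)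
  qed (use t in simp)
  finally show "norm x \<le> 1 + t * support_fun K (sgn x)" .
qed

lemma vol_unit_ball: "vol (ball 0 1 :: 'a::euclidean_space set) = vol (cball 0 1 :: 'a set)"
  using vol_convex_interior[of "cball 0 1 :: 'a set"] by (simp del: measure_completion)

theorem urysohn:
  fixes K :: "'a::euclidean_space set"
  assumes K: "convex_body K" and 0: "0 \<in> interior K"
  shows "real DIM('a) * vol (cball 0 1 :: 'a set) * vrad K \<le> (\<integral>u. support_fun K u \<partial>(sphere_measure :: 'a measure))"
    (is "_ \<le> ?I")
proof -
  let ?\<sigma> = "sphere_measure :: 'a measure" and ?n = "DIM('a)" and ?h = "support_fun K"
  interpret finite_measure ?\<sigma> by (rule finite_measure_sphere_measure)
  define \<omega> where "\<omega> = vol (cball 0 1 :: 'a set)"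
  have \<omega>: "0 < \<omega>" using vol_unit_cball_pos[where 'a='a] by (simp add: \<omega>_def del: measure_completion)
  have mass: "measure ?\<sigma> (space ?\<sigma>) = ?n * \<omega>" by (simp only: measure_space_sphere_measure \<omega>_def)
  have bK: "bounded K" and cK: "convex K" and ne: "K \<noteq> {}"
    using K 0 interior_subset by (auto simp: convex_body_def compact_imp_bounded)
  note cont = continuous_on_support_fun[OF bK ne]
  obtain R where "0 < R" and R: "\<And>u. norm u = 1 \<Longrightarrow> \<bar>?h u\<bar> \<le> R"
    using bounded_on_unit_sphere[OF cont] by blast
  have v0: "0 \<le> vrad K" by (simp add: vrad_def)
  have rootK: "root ?n (vol K) = root ?n \<omega> * vrad K"
    using \<omega> by (simp add: vrad_eq_root real_root_divide \<omega>_def[symmetric] del: measure_completion)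
  \<comment> \<open>\<open>C\<close> is the coefficient of the square of \<open>t\<close> after
    integrating the upper bound over the sphere.\<close>
  define C where "C = ?n * \<omega> * (?n + (?n * (R + 1))\<^sup>2)"
  \<comment> \<open>For \<open>t\<close> up to this value, the increment of the base is at most
    \<open>t * (R + 1)\<close>, and \<open>n\<close> times that is at most 1, as
    \<open>power_one_plus_le\<close> requires.\<close>
  define t\<^sub>0 where "t\<^sub>0 = 1 / (?n * (R + 1))"
  have nR: "1 \<le> ?n * (R + 1)"
  proof -
    have "1 * 1 \<le> ?n * (R + 1)" using \<open>0 < R\<close> by (intro mult_mono) (auto simp: Suc_le_eq)
    then show ?thesis by simp
  qed
  then have t0: "0 < t\<^sub>0" "t\<^sub>0 \<le> 1" by (auto simp: t\<^sub>0_def)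
  \<comment> \<open>The constant terms of both bounds are the surface measure
    \<open>?n * \<omega>\<close> and cancel. What remains is divided by \<open>t\<close>.\<close>
  have main: "?n * (?n * \<omega> * vrad K) \<le> ?n * ?I + t * C" if t: "0 < t" "t \<le> t\<^sub>0" for t
  proof -
    let ?T = "(\<lambda>x. t *\<^sub>R x) ` interior K"
    have T: "open ?T" "bounded ?T" "?T \<noteq> {}"
      using t 0 bK by (auto intro!: open_scaling bounded_scaling bounded_interior)
    have "root ?n (vol ?T) = t * root ?n (vol K)"
      using t by (simp add: vol_scaleR_image vol_convex_interior[OF cK bK] real_root_mult real_root_pos2
        del: measure_completion)
    then have "root ?n (vol (ball 0 1 :: 'a set)) + root ?n (vol ?T) = root ?n \<omega> * (1 + t * vrad K)"
      by (simp add: rootK vol_unit_ball \<omega>_def[symmetric] algebra_simps del: measure_completion)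
    then have "\<omega> * (1 + t * vrad K) ^ ?n \<le> vol (ball 0 1 + ?T)"
      using brunn_minkowski_open[of "ball 0 1 :: 'a set" ?T] T \<omega>
      by (simp add: brunn_minkowski_def power_mult_distrib del: measure_completion)
    \<comment> \<open>Bernoulli's inequality extracts the first-order term of the lower
      bound.\<close>
    moreover have "1 + ?n * (t * vrad K) \<le> (1 + t * vrad K) ^ ?n"
      using t v0 by (intro Bernoulli_inequality) (simp add: order.trans[of _ 0])
    ultimately have "\<omega> * (1 + ?n * (t * vrad K)) \<le> vol (ball 0 1 + ?T)"
      using \<omega> by (meson mult_left_mono less_imp_le order.trans)
    then have "?n * (\<omega> * (1 + ?n * (t * vrad K))) \<le> ?n * vol (ball 0 1 + ?T)"
      by (intro mult_left_mono) auto
    also have "\<dots> \<le> (\<integral>u. (1 + t * ?h u + t\<^sup>2) ^ ?n \<partial>?\<sigma>)" by (rule vol_ball_sum_le[OF bK 0 t(1)])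
    also have "\<dots> \<le> (\<integral>u. (1 + ?n * t\<^sup>2 + (?n * (t * (R + 1)))\<^sup>2) + (?n * t) * ?h u \<partial>?\<sigma>)"
    proof (rule integral_mono)
      fix u assume "u \<in> space ?\<sigma>"
      then have u: "norm u = 1" by (simp add: space_sphere_measure)
      have h: "0 < ?h u" "?h u \<le> R" using support_fun_pos[OF bK 0 u] R[OF u] by auto
      have y: "0 \<le> t * ?h u + t\<^sup>2" "t * ?h u + t\<^sup>2 \<le> t * (R + 1)"
        using h t t0 by (auto simp: power2_eq_square distrib_left[symmetric] intro!: mult_left_mono)
      have "?n * (t * (R + 1)) \<le> ?n * (t\<^sub>0 * (R + 1))"
        using t \<open>0 < R\<close> by (intro mult_left_mono mult_right_mono) auto
      also have "\<dots> = 1" using \<open>0 < R\<close> by (simp add: t\<^sub>0_def)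
      finally have le1: "?n * (t * ?h u + t\<^sup>2) \<le> 1"
        using mult_left_mono[OF y(2), of "real ?n"] by linarith
      have "(1 + t * ?h u + t\<^sup>2) ^ ?n = (1 + (t * ?h u + t\<^sup>2)) ^ ?n" by (simp add: add.assoc)
      also have "\<dots> \<le> 1 + ?n * (t * ?h u + t\<^sup>2) + (?n * (t * ?h u + t\<^sup>2))\<^sup>2"
        by (rule power_one_plus_le[OF y(1) le1])
      also have "\<dots> \<le> 1 + ?n * (t * ?h u + t\<^sup>2) + (?n * (t * (R + 1)))\<^sup>2"
        using y t by (intro add_mono power_mono mult_left_mono) auto
      finally show "(1 + t * ?h u + t\<^sup>2) ^ ?n \<le> (1 + ?n * t\<^sup>2 + (?n * (t * (R + 1)))\<^sup>2) + (?n * t) * ?h u"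
        by (simp add: algebra_simps)
    qed (intro integrable_sphere_measure continuous_intros cont)+
    also have "\<dots> = (1 + ?n * t\<^sup>2 + (?n * (t * (R + 1)))\<^sup>2) * (?n * \<omega>) + (?n * t) * ?I"
      using integrable_sphere_measure[OF cont] by (subst Bochner_Integration.integral_add) (auto simp: mass)
    finally have "t * (?n * (?n * \<omega> * vrad K)) \<le> t * (?n * ?I + t * C)"
      by (simp add: C_def algebra_simps power2_eq_square)
    then show ?thesis using t by simp
  qed
  have "?n * (?n * \<omega> * vrad K) \<le> ?n * ?I"
  proof (rule field_le_epsilon)
    fix e :: real assume "0 < e"
    have C: "0 \<le> C" using \<omega> by (auto simp: C_def intro!: mult_nonneg_nonneg add_nonneg_nonneg)
    \<comment> \<open>This makes the error \<open>t * C\<close> at most \<open>e\<close>; the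
      denominator \<open>C + 1\<close> stays positive even if \<open>C\<close> vanishes.\<close>
    define t where "t = min t\<^sub>0 (e / (C + 1))"
    have t: "0 < t" "t \<le> t\<^sub>0" using t0 C \<open>0 < e\<close> by (auto simp: t_def)
    have "t * C \<le> e / (C + 1) * (C + 1)" using C t \<open>0 < e\<close> by (intro mult_mono) (auto simp: t_def)
    also have "\<dots> = e" using C by simp
    finally show "?n * (?n * \<omega> * vrad K) \<le> ?n * ?I + e" using main[OF t] by linarith
  qed
  then show ?thesis by (simp add: \<omega>_def del: measure_completion)
qed

section \<open>Jensen's inequality on the sphere\<close>

text \<open>A point with \<open>f u\<close> different from \<open>m\<close> produces, by continuity,
  a nonempty open set inside the cone over the exceptional set. That cone, however, has volume
  0.\<close>

lemma AE_sphere_eq_const_imp_eq: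
  fixes f :: "'a::euclidean_space \<Rightarrow> real"
  assumes f: "continuous_on (sphere 0 1) f" and ae: "AE u in sphere_measure. f u = m" and u: "norm u = 1"
  shows "f u = m"
proof (rule ccontr)
  assume "f u \<noteq> m"
  interpret finite_measure "sphere_measure :: 'a measure" by (rule finite_measure_sphere_measure)
  define A where "A = {u \<in> sphere 0 1. f u \<noteq> m}"
  have As: "A \<in> sets sphere_measure"
  proof -
    have "A = f -` (- {m}) \<inter> space sphere_measure" by (auto simp: A_def space_sphere_measure)
    then show ?thesis using borel_measurable_sphere_measure[OF f] by (auto intro!: measurable_sets)
  qed
  then have A: "A \<in> sets borel" "A \<subseteq> sphere 0 1"
    by (auto simp: sets_sphere_measure sets_restrict_space_iff A_def)
  have "AE u in sphere_measure. u \<notin> A" using ae by eventually_elim (auto simp: A_def)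
  then have "measure sphere_measure A = 0"
    using As by (simp add: AE_iff_measurable[of A] measure_eq_0_null_sets null_sets_def
      sets.sets_into_space Collect_conj_eq Int_absorb1 subset_iff)
  then have zero: "vol (radial_cone 1 A) = 0" using vol_radial_cone[OF A, of 1] by (simp del: measure_completion)
  define U where "U = (ball 0 1 - {0}) \<inter> (\<lambda>x. f (sgn x)) -` (- {m})"
  have "continuous_on (ball 0 1 - {0}) (\<lambda>x. f (sgn x))"
    by (intro continuous_on_compose2[OF f] continuous_intros) (auto simp: norm_sgn split: if_splits)
  then have "open U" unfolding U_def by (intro continuous_open_preimage) auto
  moreover have "(1/2) *\<^sub>R u \<in> U" using u \<open>f u \<noteq> m\<close> by (auto simp: U_def sgn_scaleR sgn_div_norm)
  moreover have "U \<subseteq> radial_cone 1 A" by (auto simp: U_def radial_cone_def A_def norm_sgn)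
  moreover have "bounded U" by (rule bounded_subset[of "ball 0 1"]) (auto simp: U_def)
  ultimately have "0 < vol U" by (intro vol_open_pos) auto
  also have "vol U \<le> vol (radial_cone 1 A)"
    using \<open>open U\<close> \<open>U \<subseteq> radial_cone 1 A\<close> lmeasurable_radial_cone[OF A(1)] by (intro measure_mono_fmeasurable) auto
  finally show False using zero by simp
qed

text \<open>The slope is the infimum of the secant slopes to the right of \<open>m\<close>, that is,
  the right derivative.\<close>

lemma convex_supporting_line:
  fixes \<phi> :: "real \<Rightarrow> real"
  assumes "convex_on {0<..} \<phi>" "0 < m"
  obtains c where "\<And>x. 0 < x \<Longrightarrow> \<phi> m + c * (x - m) \<le> \<phi> x"
proof (rule that)
  fix x :: real assume "0 < x"
  then show "\<phi> m + Inf ((\<lambda>t. (\<phi> m - \<phi> t) / (m - t)) ` ({m<..} \<inter> {0<..})) * (x - m) \<le> \<phi> x"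
    using assms by (intro convex_le_Inf_differential) (simp_all add: interior_open)
qed

text \<open>Strict convexity at the midpoint of \<open>x\<close> and \<open>m\<close>, where the
  line still lies below \<open>\<phi>\<close>, forces a strict gap at \<open>x\<close>.\<close>

lemma strictly_convex_supporting_line_less:
  fixes \<phi> :: "real \<Rightarrow> real"
  assumes conv: "strictly_convex_on {0<..} \<phi>" and line: "\<And>x. 0 < x \<Longrightarrow> \<phi> m + c * (x - m) \<le> \<phi> x"
    and "0 < m" "0 < x" "x \<noteq> m"
  shows "\<phi> m + c * (x - m) < \<phi> x"
proof -
  have "\<phi> ((1/2) *\<^sub>R x + (1/2) *\<^sub>R m) < 1/2 * \<phi> x + 1/2 * \<phi> m"
    by (rule conv[unfolded strictly_convex_on_def, THEN conjunct2, rule_format]) (use assms(3-5) in auto)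
  moreover have "\<phi> m + c * ((1/2) *\<^sub>R x + (1/2) *\<^sub>R m - m) \<le> \<phi> ((1/2) *\<^sub>R x + (1/2) *\<^sub>R m)"
    using assms by (intro line) simp
  ultimately show ?thesis by (simp add: algebra_simps)
qed

text \<open>Integrate the nonnegative gap \<open>d\<close> between \<open>\<phi> (f u)\<close> and
  the supporting line at \<open>m\<close>; since \<open>m\<close> is the mean of \<open>f\<close>,
  the line integrates to the total mass times \<open>\<phi> m\<close>. If equality holds, the gap
  vanishes almost everywhere, so \<open>f\<close> equals \<open>m\<close> almost everywhere, and by
  continuity everywhere.\<close>

lemma jensen_sphere:
  fixes f :: "'a::euclidean_space \<Rightarrow> real" and \<phi> :: "real \<Rightarrow> real"
  assumes f: "continuous_on (sphere 0 1) f" and pos: "\<And>u. norm u = 1 \<Longrightarrow> 0 < f u"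
    and \<phi>: "convex_on {0<..} \<phi>" and "0 < m"
    and m: "(\<integral>u. f u \<partial>(sphere_measure :: 'a measure)) = real DIM('a) * vol (cball 0 1 :: 'a set) * m"
  shows "real DIM('a) * vol (cball 0 1 :: 'a set) * \<phi> m \<le> (\<integral>u. \<phi> (f u) \<partial>sphere_measure)"
    and "\<lbrakk>strictly_convex_on {0<..} \<phi>;
      (\<integral>u. \<phi> (f u) \<partial>sphere_measure) = real DIM('a) * vol (cball 0 1 :: 'a set) * \<phi> m;
      norm u = 1\<rbrakk> \<Longrightarrow> f u = m"
proof -
  let ?\<sigma> = "sphere_measure :: 'a measure" and ?N = "real DIM('a) * vol (cball 0 1 :: 'a set)"
  interpret finite_measure ?\<sigma> by (rule finite_measure_sphere_measure)
  obtain c where c: "\<And>x. 0 < x \<Longrightarrow> \<phi> m + c * (x - m) \<le> \<phi> x"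
    using convex_supporting_line[OF \<phi> \<open>0 < m\<close>] by blast
  define d where "d u = \<phi> (f u) - (\<phi> m + c * (f u - m))" for u
  have \<phi>f: "continuous_on (sphere 0 1) (\<lambda>u. \<phi> (f u))"
    by (rule continuous_on_compose2[OF convex_on_continuous[OF _ \<phi>] f]) (auto intro: pos)
  have intd: "integrable ?\<sigma> d"
    unfolding d_def by (intro integrable_sphere_measure continuous_intros \<phi>f f)
  have nonneg: "AE u in ?\<sigma>. 0 \<le> d u"
    using c pos by (auto intro!: AE_I2 simp: d_def space_sphere_measure)
  have "(\<integral>u. d u \<partial>?\<sigma>) = (\<integral>u. \<phi> (f u) \<partial>?\<sigma>) - (\<integral>u. (\<phi> m - c * m) + c * f u \<partial>?\<sigma>)"
    unfolding d_def
    by (subst Bochner_Integration.integral_diff[symmetric])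
      (auto intro!: integrable_sphere_measure continuous_intros \<phi>f f Bochner_Integration.integral_cong
        simp: algebra_simps)
  also have "(\<integral>u. (\<phi> m - c * m) + c * f u \<partial>?\<sigma>) = (\<phi> m - c * m) * ?N + c * (\<integral>u. f u \<partial>?\<sigma>)"
    using integrable_sphere_measure[OF f] by (subst Bochner_Integration.integral_add)
      (auto simp: measure_space_sphere_measure simp del: measure_completion)
  also have "\<dots> = ?N * \<phi> m" unfolding m by (simp add: algebra_simps del: measure_completion)
  finally have intd_eq: "(\<integral>u. d u \<partial>?\<sigma>) = (\<integral>u. \<phi> (f u) \<partial>?\<sigma>) - ?N * \<phi> m" .
  show "?N * \<phi> m \<le> (\<integral>u. \<phi> (f u) \<partial>?\<sigma>)"
    using integral_nonneg_AE[OF nonneg] intd_eq by linarith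
  assume strict: "strictly_convex_on {0<..} \<phi>" and eq: "(\<integral>u. \<phi> (f u) \<partial>?\<sigma>) = ?N * \<phi> m" and u: "norm u = 1"
  have "AE u in ?\<sigma>. d u = 0"
    using integral_nonneg_eq_0_iff_AE[OF intd nonneg] intd_eq eq by simp
  then have "AE u in ?\<sigma>. f u = m"
  proof (rule AE_mp, intro AE_I2 impI)
    fix u assume "u \<in> space ?\<sigma>" "d u = 0"
    then show "f u = m"
      using strictly_convex_supporting_line_less[OF strict c \<open>0 < m\<close> pos[of u]]
      by (auto simp: d_def space_sphere_measure)
  qed
  then show "f u = m" by (rule AE_sphere_eq_const_imp_eq[OF f _ u])
qed

section \<open>The Orlicz--Urysohn inequality\<close>

lemma orlicz_mean_width_scaled_cball:
  assumes "0 \<le> r"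
  shows "orlicz_mean_width \<phi> ((\<lambda>x. r *\<^sub>R x) ` cball 0 1 :: 'a::euclidean_space set) = \<phi> r"
proof -
  let ?\<sigma> = "sphere_measure :: 'a measure"
  interpret finite_measure ?\<sigma> by (rule finite_measure_sphere_measure)
  have "(\<integral>u. \<phi> (support_fun ((\<lambda>x. r *\<^sub>R x) ` cball 0 1) u) \<partial>?\<sigma>) = (\<integral>u. \<phi> r \<partial>?\<sigma>)"
    using assms by (intro Bochner_Integration.integral_cong)
      (auto simp: support_fun_scaled_cball space_sphere_measure)
  then show ?thesis
    using vol_unit_cball_pos[where 'a='a]
    by (simp add: orlicz_mean_width_def measure_space_sphere_measure del: measure_completion)
qed

lemma vrad_scaled_cball:
  assumes "0 \<le> r"
  shows "vrad ((\<lambda>x. r *\<^sub>R x) ` cball 0 1 :: 'a::euclidean_space set) = r"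
proof -
  have "vol ((\<lambda>x. r *\<^sub>R x) ` cball 0 1 :: 'a set) / vol (cball 0 1 :: 'a set) = r ^ DIM('a)"
    unfolding vol_scaleR_image using assms vol_unit_cball_pos[where 'a='a]
    by (simp del: measure_completion)
  then show ?thesis unfolding vrad_eq_root using assms by (simp add: real_root_power_cancel)
qed

lemma vrad_pos:
  fixes K :: "'a::euclidean_space set"
  assumes "convex_body K"
  shows "0 < vrad K"
proof -
  have "0 < vol (interior K)"
    using assms by (intro vol_open_pos) (auto simp: convex_body_def compact_imp_bounded bounded_interior)
  then have "0 < vol K"
    using assms by (simp add: vol_convex_interior convex_body_def compact_imp_bounded del: measure_completion)
  then show ?thesis using vol_unit_cball_pos[where 'a='a] by (simp add: vrad_eq_root del: measure_completion)
qed

theorem theorem3p3: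
  fixes K :: "'a::euclidean_space set" and \<phi> :: "real \<Rightarrow> real"
  assumes "convex_body K"
    and "0 \<in> interior K"
    and "\<forall>t>0. \<phi> t > 0"
    and "mono_on {0<..} \<phi>"
    and "convex_on {0<..} \<phi>"
  shows "orlicz_mean_width \<phi> K \<ge> orlicz_mean_width \<phi> (vrad_ball K) \<and>
    (strictly_convex_on {0<..} \<phi> \<longrightarrow>
      (orlicz_mean_width \<phi> K = orlicz_mean_width \<phi> (vrad_ball K) \<longleftrightarrow> origin_symmetric_ball K))"
proof -
  let ?\<sigma> = "sphere_measure :: 'a measure"
  define N where "N = real DIM('a) * vol (cball 0 1 :: 'a set)"
  have N: "0 < N" using vol_unit_cball_pos[where 'a='a] by (simp add: N_def del: measure_completion)
  have K: "compact K" "bounded K" "convex K" "K \<noteq> {}"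
    using assms(1) interior_subset by (auto simp: convex_body_def compact_imp_bounded)
  note cont = continuous_on_support_fun[OF K(2,4)]
  have pos: "0 < support_fun K u" if "norm u = 1" for u
    using support_fun_pos[OF K(2) assms(2) that] .
  note v = vrad_pos[OF assms(1)]
  define m where "m = (\<integral>u. support_fun K u \<partial>?\<sigma>) / N"
  have m: "(\<integral>u. support_fun K u \<partial>?\<sigma>) = N * m" using N by (simp add: m_def)
  have vm: "vrad K \<le> m"
    using urysohn[OF assms(1,2)] N by (simp add: m_def N_def[symmetric] le_divide_eq mult.commute[of "vrad K"] del: measure_completion)
  then have m0: "0 < m" using v by linarith
  note m' = m[unfolded N_def]
  have width: "orlicz_mean_width \<phi> K = (\<integral>u. \<phi> (support_fun K u) \<partial>?\<sigma>) / N"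
    by (simp add: orlicz_mean_width_def N_def)
  have ball: "orlicz_mean_width \<phi> (vrad_ball K) = \<phi> (vrad K)"
    using v by (simp add: vrad_ball_def orlicz_mean_width_scaled_cball)
  have \<phi>m: "\<phi> (vrad K) \<le> \<phi> m" using v m0 vm by (intro mono_onD[OF assms(4)]) auto
  have "N * \<phi> m \<le> (\<integral>u. \<phi> (support_fun K u) \<partial>?\<sigma>)"
    unfolding N_def by (rule jensen_sphere(1)[OF cont pos assms(5) m0 m'])
  then have le: "\<phi> m \<le> orlicz_mean_width \<phi> K" using N by (simp add: width le_divide_eq mult.commute)
  have "origin_symmetric_ball K"
    if strict: "strictly_convex_on {0<..} \<phi>" and eq: "orlicz_mean_width \<phi> K = orlicz_mean_width \<phi> (vrad_ball K)"
  proof -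
    \<comment> \<open>Equality of the outer terms collapses the chain from
      \<open>\<phi> (vrad K)\<close> through \<open>\<phi> m\<close> to the mean width of
      \<open>K\<close>, so Jensen's inequality is an equality.\<close>
    have "orlicz_mean_width \<phi> K = \<phi> m" using eq ball \<phi>m le by linarith
    then have Jeq: "(\<integral>u. \<phi> (support_fun K u) \<partial>?\<sigma>) = N * \<phi> m" using N by (simp add: width field_simps)
    have "support_fun K u = m" if "norm u = 1" for u
      by (rule jensen_sphere(2)[OF cont pos assms(5) m0 m' strict Jeq[unfolded N_def] that])
    then have "K = cball 0 m" by (intro eq_cball_if_support_fun_const K m0)
    also have "\<dots> = (\<lambda>x. m *\<^sub>R x) ` cball 0 1" using m0 by (subst cball_scale) auto
    finally show ?thesis using m0 by (auto simp: origin_symmetric_ball_def)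
  qed
  moreover have "orlicz_mean_width \<phi> K = orlicz_mean_width \<phi> (vrad_ball K)" if "origin_symmetric_ball K"
  proof -
    obtain r where "0 < r" "K = (\<lambda>x. r *\<^sub>R x) ` cball 0 1"
      using \<open>origin_symmetric_ball K\<close> by (auto simp: origin_symmetric_ball_def)
    \<comment> \<open>A centred ball has its own radius as volume radius, so it coincides with its
      comparison ball.\<close>
    then have "vrad_ball K = K" by (simp add: vrad_ball_def vrad_scaled_cball)
    then show ?thesis by simp
  qed
  ultimately show ?thesis using ball \<phi>m le by auto
qed

end
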